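(* Let $k\ge 2$ be an integer. Let $q$ range over prime powers with $q\equiv 3\pmod 4$, $q\to\infty$, and let $\mathcal{E}=\mathcal{E}_q\subseteq\mathbb{F}_q^2$ be sets such that $q^{1+\frac{1}{4k-1}}=o(|\mathcal{E}|)$, i.e. $q^{1+\frac{1}{4k-1}}/|\mathcal{E}|\to 0$ as $q\to\infty$. Then \[|k\Delta_{\mathbb{F}_q}(\mathcal{E})|=(1-o(1))q,\] i.e. $|k\Delta_{\mathbb{F}_q}(\mathcal{E})|/q\to 1$ as $q\to\infty$.
   Context: $\mathbb{F}_q$ is the finite field of order $q$. For $\mathbf{x},\mathbf{y}\in\mathbb{F}_q^d$ put $||\mathbf{x}-\mathbf{y}||=(x_1-y_1)^2+\cdots+(x_d-y_d)^2\in\mathbb{F}_q$ (here $d=2$). For $\mathcal{E}\subseteq\mathbb{F}_q^d$, the distance set is $\Delta_{\mathbb{F}_q}(\mathcal{E})=\{||\mathbf{x}-\mathbf{y}||\colon \mathbf{x},\mathbf{y}\in\mathcal{E}\}\subseteq\mathbb{F}_q$, and $k\Delta_{\mathbb{F}_q}(\mathcal{E})=\Delta_{\mathbb{F}_q}(\mathcal{E})+\cdots+\Delta_{\mathbb{F}_q}(\mathcal{E})$ ($k$ times) is the $k$-fold sumset $\{t_1+\cdots+t_k\colon t_i\in\Delta_{\mathbb{F}_q}(\mathcal{E})\}$. The notation $X=o(Y)$ means $X/Y\to 0$ as $q\to\infty$, where $X,Y$ are viewed as functions of $q$. *)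

theory Defs
  imports "HOL-Algebra.Algebra" "HOL-Number_Theory.Prime_Powers" "HOL-Library.Landau_Symbols"
begin

text \<open>
  Finite fields are given as HOL-Algebra structures with explicit carrier, because the
  theorem concerns a whole family of fields of growing order.
\<close>

definition sqdist :: "('a, 'm) ring_scheme \<Rightarrow> 'a \<times> 'a \<Rightarrow> 'a \<times> 'a \<Rightarrow> 'a" where
  "sqdist R x y =
     (fst x \<ominus>\<^bsub>R\<^esub> fst y) [^]\<^bsub>R\<^esub> (2::nat) \<oplus>\<^bsub>R\<^esub> (snd x \<ominus>\<^bsub>R\<^esub> snd y) [^]\<^bsub>R\<^esub> (2::nat)"

definition distance_set :: "('a, 'm) ring_scheme \<Rightarrow> ('a \<times> 'a) set \<Rightarrow> 'a set" where
  "distance_set R E = {sqdist R x y | x y. x \<in> E \<and> y \<in> E}"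

definition kfold_sumset :: "('a, 'm) ring_scheme \<Rightarrow> nat \<Rightarrow> 'a set \<Rightarrow> 'a set" where
  "kfold_sumset R k A =
     {(\<Oplus>\<^bsub>R\<^esub>i\<in>{1..k}. t i) | t :: nat \<Rightarrow> 'a. \<forall>i\<in>{1..k}. t i \<in> A}"

definition admissible_orders :: "nat set" where
  "admissible_orders = {q. primepow q \<and> q mod 4 = 3}"

text \<open>The filter of \<open>q \<rightarrow> \<infinity>\<close> along the admissible orders only.\<close>

definition admissible_at_top :: "nat filter" where
  "admissible_at_top = inf at_top (principal admissible_orders)"

end

theory Submission
  imports Defs "HOL-Analysis.Convex"
begin

text \<open>
  Let \<open>m = |E|\<close> and let \<open>\<nu>(t)\<close> count the pairs of \<open>E\<close> at distance \<open>t\<close>. By Cauchy-Schwarz it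
  suffices that the \<open>k\<close>-fold convolution power of \<open>\<nu>\<close> is close in \<open>L\<^sup>2\<close> to its mean. On
  functions of mean zero, convolution with \<open>\<nu>\<close> has norm at most \<open>q m\<close>, because
  \<open>||x - y|| - ||x - z||\<close> is a nonconstant affine function of \<open>x\<close> when \<open>y \<noteq> z\<close>. This
  handles \<open>k - 1\<close> of the factors and loses only in the last one, where one needs the deviation
  \<open>\<Sum>\<^sub>t (\<nu>(t) - m\<^sup>2/q)\<^sup>2\<close> to be \<open>O(q m\<^bsup>5/2\<^esup>)\<close> up to smaller terms.

  That deviation is at most \<open>m\<close> times the excess of isosceles triangles over \<open>m\<^sup>3/q\<close>. An
  isosceles triangle with base \<open>y \<noteq> z\<close> is a point on the axis of the unique reflection exchanging
  \<open>y\<close> and \<open>z\<close>, so Cauchy-Schwarz over the axes bounds the excess by the variance of point-line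
  incidences (at most \<open>q m\<close>) and the bisector energy, which is \<open>O(q m\<^sup>2)\<close> plus a smaller term by
  a second-moment argument for reflections acting on pairs of points at a fixed distance.
\<close>

subsection \<open>Isosceles triangles and bisector energy\<close>

lemma sum_of_bool_mult:
  assumes "finite A" "a \<in> A"
  shows "(\<Sum>x\<in>A. of_bool (x = a) * f x) = (f a :: real)"
    and "(\<Sum>x\<in>A. of_bool (a = x) * f x) = (f a :: real)"
  using assms by (simp_all add: of_bool_def if_distrib[of "\<lambda>u. u * _"] cong: if_cong)

lemma sum_of_bool_ex1:
  assumes "finite A" "\<exists>!l. l \<in> A \<and> P l" shows "(\<Sum>l\<in>A. of_bool (P l)) = (1::real)"
proof -
  obtain a where a: "a \<in> A" "P a" "\<And>l. l \<in> A \<Longrightarrow> P l \<Longrightarrow> l = a" using assms(2) by metis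
  have "P l \<longleftrightarrow> l = a" if "l \<in> A" for l using a that by blast
  then have "(\<Sum>l\<in>A. of_bool (P l)) = (\<Sum>l\<in>A. of_bool (l = a) * (1::real))"
    by (intro sum.cong refl) simp
  then show ?thesis using sum_of_bool_mult(1)[OF assms(1) a(1), of "\<lambda>_. 1"] by simp
qed

text \<open>An axiomatic finite affine plane with its reflections, so that the counting below needs
  no coordinates. An element of \<open>L\<close> stands both for a reflection and for its axis:
  \<open>mir l x = x\<close> says that \<open>x\<close> lies on the axis.\<close>

locale mirror_plane =
  fixes V :: "'v set" and L :: "'l set" and mir :: "'l \<Rightarrow> 'v \<Rightarrow> 'v"
    and dst :: "'v \<Rightarrow> 'v \<Rightarrow> 'd" and q :: nat
  assumes finite_V: "finite V" and finite_L: "finite L" and q_pos: "q > 0"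
    and card_V: "card V = q\<^sup>2" and card_L: "card L = q * (q + 1)"
    and mir_closed: "\<And>l y. l \<in> L \<Longrightarrow> y \<in> V \<Longrightarrow> mir l y \<in> V"
    and mir_mir: "\<And>l y. l \<in> L \<Longrightarrow> y \<in> V \<Longrightarrow> mir l (mir l y) = y"
    and mir_isometry: "\<And>l y z. l \<in> L \<Longrightarrow> y \<in> V \<Longrightarrow> z \<in> V \<Longrightarrow> dst (mir l y) (mir l z) = dst y z"
    and ex1_bisector: "\<And>y z. y \<in> V \<Longrightarrow> z \<in> V \<Longrightarrow> y \<noteq> z \<Longrightarrow> \<exists>!l. l \<in> L \<and> mir l y = z"
    and equidistant_fixed: "\<And>l x y. l \<in> L \<Longrightarrow> x \<in> V \<Longrightarrow> y \<in> V \<Longrightarrow> mir l y \<noteq> y \<Longrightarrow>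
      dst x y = dst x (mir l y) \<Longrightarrow> mir l x = x"
    and card_lines_through: "\<And>y. y \<in> V \<Longrightarrow> card {l \<in> L. mir l y = y} = q + 1"
    and ex1_line: "\<And>y z. y \<in> V \<Longrightarrow> z \<in> V \<Longrightarrow> y \<noteq> z \<Longrightarrow> \<exists>!l. l \<in> L \<and> mir l y = y \<and> mir l z = z"
    and card_common_images: "\<And>a a' c c'. a \<in> V \<Longrightarrow> a' \<in> V \<Longrightarrow> c \<in> V \<Longrightarrow> c' \<in> V \<Longrightarrow>
      a \<noteq> a' \<Longrightarrow> (a, a') \<noteq> (c, c') \<Longrightarrow>
      card {(l, l') \<in> L \<times> L. mir l a = mir l' c \<and> mir l a' = mir l' c'} \<le> q + 1"
begin

text \<open>One point \<open>w\<close> of the circle yields all others: \<open>v\<close> is the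
  mirror image of \<open>w\<close> in their bisector, whose axis passes through the centre
  \<open>u\<close> by \<open>equidistant_fixed\<close>, and \<open>w\<close> is its own image in the
  line joining it to \<open>u\<close>. So the \<open>q + 1\<close> lines through \<open>u\<close>
  suffice.\<close>

lemma card_circle:
  assumes u: "u \<in> V"
  shows "card {v \<in> V. v \<noteq> u \<and> dst u v = d} \<le> q + 1"
proof (cases "\<exists>w \<in> V. w \<noteq> u \<and> dst u w = d")
  case True
  then obtain w where w: "w \<in> V" "w \<noteq> u" "dst u w = d" by blast
  let ?F = "{l \<in> L. mir l u = u}"
  have "{v \<in> V. v \<noteq> u \<and> dst u v = d} \<subseteq> (\<lambda>l. mir l w) ` ?F"
  proof safe
    fix v assume v: "v \<in> V" "v \<noteq> u" "d = dst u v"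
    show "v \<in> (\<lambda>l. mir l w) ` ?F"
    proof (cases "v = w")
      case True
      obtain l where "l \<in> L" "mir l u = u" "mir l w = w"
        using ex1_line[OF u w(1)] w(2) by blast
      with True show ?thesis by force
    next
      case False
      then obtain l where l: "l \<in> L" "mir l w = v"
        using ex1_bisector[OF w(1) v(1)] by blast
      then have "mir l u = u"
        using equidistant_fixed[OF l(1) u w(1)] False v(3) w(3) by simp
      with l show ?thesis by force
    qed
  qed
  then have "card {v \<in> V. v \<noteq> u \<and> dst u v = d} \<le> card ?F"
    using finite_L by (intro surj_card_le) auto
  then show ?thesis using card_lines_through[OF u] by simp
next
  case False
  then have "{v \<in> V. v \<noteq> u \<and> dst u v = d} = {}" by blast
  then show ?thesis by (metis card.empty zero_le)
qed

section \<open>Reflections acting on ordered pairs of distinct points\<close>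

definition npairs :: "'v set \<Rightarrow> ('v \<times> 'v) set" where
  "npairs A = {e \<in> A \<times> A. fst e \<noteq> snd e}"

definition mir2 :: "'l \<Rightarrow> 'v \<times> 'v \<Rightarrow> 'v \<times> 'v" where
  "mir2 l e = (mir l (fst e), mir l (snd e))"

abbreviation dst2 :: "'v \<times> 'v \<Rightarrow> 'd" where
  "dst2 e \<equiv> dst (fst e) (snd e)"

lemma finite_npairs: "A \<subseteq> V \<Longrightarrow> finite (npairs A)"
  unfolding npairs_def using finite_V by (simp add: finite_subset)

lemma npairs_mono: "A \<subseteq> V \<Longrightarrow> npairs A \<subseteq> npairs V"
  unfolding npairs_def by auto

lemma mir2_closed: "l \<in> L \<Longrightarrow> e \<in> npairs V \<Longrightarrow> mir2 l e \<in> npairs V"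
  unfolding npairs_def mir2_def using mir_closed mir_mir by (auto, metis)

lemma mir2_mir2: "l \<in> L \<Longrightarrow> e \<in> npairs V \<Longrightarrow> mir2 l (mir2 l e) = e"
  unfolding npairs_def mir2_def using mir_mir by auto

lemma mir2_isometry: "l \<in> L \<Longrightarrow> e \<in> npairs V \<Longrightarrow> dst2 (mir2 l e) = dst2 e"
  unfolding npairs_def mir2_def using mir_isometry by auto

text \<open>If both points are fixed, the axis is the line through them; otherwise it is the
  bisector of a moved point and its image.\<close>

lemma mir2_inj:
  assumes l: "l \<in> L" "l' \<in> L" and e: "e \<in> npairs V" and eq: "mir2 l e = mir2 l' e"
  shows "l = l'"
proof -
  obtain a b where ab: "e = (a, b)" "a \<in> V" "b \<in> V" "a \<noteq> b"
    using e unfolding npairs_def by (cases e) auto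
  have eqs: "mir l' a = mir l a" "mir l' b = mir l b"
    using eq ab(1) unfolding mir2_def by auto
  show ?thesis
  proof (cases "mir l a = a \<and> mir l b = b")
    case True
    then show ?thesis using ex1_line[OF ab(2,3,4)] l eqs by metis
  next
    case False
    then show ?thesis
      using ex1_bisector[OF ab(2) mir_closed[OF l(1) ab(2)]]
        ex1_bisector[OF ab(3) mir_closed[OF l(1) ab(3)]] l eqs by metis
  qed
qed

lemma card_npairs_dst:
  "card {e \<in> npairs V. dst2 e = d} \<le> q\<^sup>2 * (q + 1)"
proof -
  have "{e \<in> npairs V. dst2 e = d} = (SIGMA u:V. {v \<in> V. v \<noteq> u \<and> dst u v = d})"
    unfolding npairs_def by auto
  then have "card {e \<in> npairs V. dst2 e = d} = (\<Sum>u\<in>V. card {v \<in> V. v \<noteq> u \<and> dst u v = d})"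
    using finite_V by (simp add: card_SigmaI)
  also have "\<dots> \<le> (\<Sum>u\<in>V. q + 1)"
    by (rule sum_mono) (use card_circle in auto)
  finally show ?thesis using card_V by simp
qed

text \<open>These correlations are the terms of the expanded second moment of
  \<open>hits\<close>.\<close>

definition meet :: "'v \<times> 'v \<Rightarrow> 'v \<times> 'v \<Rightarrow> real" where
  "meet e e' = (\<Sum>l\<in>L. \<Sum>l'\<in>L. of_bool (mir2 l e = mir2 l' e'))"

text \<open>If \<open>e = e'\<close>, injectivity forces \<open>l = l'\<close>. If the distances
  differ, isometry excludes a common image. The remaining case is
  \<open>card_common_images\<close>.\<close>

lemma meet_le:
  assumes e: "e \<in> npairs V" "e' \<in> npairs V"
  shows "meet e e' \<le> of_bool (e = e') * real (card L) + real (q + 1) * of_bool (dst2 e = dst2 e')"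
proof (cases "e = e'")
  case True
  have "meet e e' = (\<Sum>l\<in>L. \<Sum>l'\<in>L. of_bool (l' = l) * 1)"
    unfolding meet_def True using mir2_inj[OF _ _ e(2)]
    by (intro sum.cong refl) (auto simp: of_bool_def)
  also have "\<dots> = (\<Sum>l\<in>L. 1)"
    by (intro sum.cong refl sum_of_bool_mult finite_L)
  finally show ?thesis using True by simp
next
  case False
  show ?thesis
  proof (cases "dst2 e = dst2 e'")
    case True
    obtain a a' c c' where ac: "e = (a, a')" "e' = (c, c')" by (metis surj_pair)
    have "meet e e' = (\<Sum>p\<in>L \<times> L. of_bool (mir2 (fst p) e = mir2 (snd p) e'))"
      unfolding meet_def by (simp add: sum.cartesian_product case_prod_beta)
    also have "\<dots> = real (card (L \<times> L \<inter> {p. mir2 (fst p) e = mir2 (snd p) e'}))"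
      using finite_L by (simp add: sum_of_bool_eq)
    also have "L \<times> L \<inter> {p. mir2 (fst p) e = mir2 (snd p) e'} =
        {(l, l') \<in> L \<times> L. mir l a = mir l' c \<and> mir l a' = mir l' c'}"
      unfolding mir2_def ac by auto
    also have "real (card \<dots>) \<le> real (q + 1)"
      using card_common_images[of a a' c c'] e False unfolding ac npairs_def
      by (simp only: of_nat_le_iff) auto
    finally show ?thesis using True False by simp
  next
    case diff: False
    have "mir2 l e \<noteq> mir2 l' e'" if "l \<in> L" "l' \<in> L" for l l'
      using mir2_isometry[OF that(1) e(1)] mir2_isometry[OF that(2) e(2)] diff by metis
    then have "meet e e' = 0" unfolding meet_def by simp
    then show ?thesis using diff False by simp
  qed
qed

section \<open>Second moment of the number of ways to reach a pair by reflecting pairs of the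
  set\<close>

definition hits :: "'v set \<Rightarrow> 'v \<times> 'v \<Rightarrow> real" where
  "hits E p = (\<Sum>e\<in>npairs E. \<Sum>l\<in>L. of_bool (mir2 l e = p))"

definition same_dst :: "'v set \<Rightarrow> real" where
  "same_dst E = (\<Sum>e\<in>npairs E. \<Sum>e'\<in>npairs E. of_bool (dst2 e = dst2 e'))"

text \<open>The factor \<open>1/q\<close> is the number \<open>q (q + 1)\<close> of reflections over the maximal number
  \<open>q\<^sup>2 (q + 1)\<close> of pairs at a given nonzero distance.\<close>

definition avg_hits :: "'v set \<Rightarrow> 'v \<times> 'v \<Rightarrow> real" where
  "avg_hits E p = (\<Sum>e\<in>npairs E. of_bool (dst2 e = dst2 p)) / real q"

context
  fixes E assumes EV: "E \<subseteq> V"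
begin

lemma sum_hits_sq:
  "(\<Sum>p\<in>npairs V. (hits E p)\<^sup>2) \<le> real (card L) * real (card (npairs E)) + real (q + 1) * same_dst E"
proof -
  let ?k = "\<lambda>e p. \<Sum>l\<in>L. of_bool (mir2 l e = p) :: real"
  note fin = finite_npairs[OF EV] finite_npairs[OF order_refl]
  have meet: "(\<Sum>p\<in>npairs V. ?k e p * ?k e' p) = meet e e'" if "e \<in> npairs E" for e e'
  proof -
    have "(\<Sum>p\<in>npairs V. ?k e p * ?k e' p) =
        (\<Sum>p\<in>npairs V. \<Sum>l\<in>L. \<Sum>l'\<in>L. of_bool (mir2 l e = p) * of_bool (mir2 l' e' = p))"
      by (simp add: sum_product)
    also have "\<dots> = (\<Sum>l\<in>L. \<Sum>p\<in>npairs V. \<Sum>l'\<in>L. of_bool (mir2 l e = p) * of_bool (mir2 l' e' = p))"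
      by (rule sum.swap)
    also have "\<dots> = (\<Sum>l\<in>L. \<Sum>l'\<in>L. \<Sum>p\<in>npairs V. of_bool (mir2 l e = p) * of_bool (mir2 l' e' = p))"
      by (intro sum.cong refl sum.swap)
    also have "\<dots> = (\<Sum>l\<in>L. \<Sum>l'\<in>L. of_bool (mir2 l' e' = mir2 l e))"
    proof (intro sum.cong refl)
      fix l l' assume "l \<in> L" "l' \<in> L"
      then have "mir2 l e \<in> npairs V" using that mir2_closed npairs_mono[OF EV] by blast
      then show "(\<Sum>p\<in>npairs V. of_bool (mir2 l e = p) * of_bool (mir2 l' e' = p)) =
          (of_bool (mir2 l' e' = mir2 l e) :: real)"
        by (rule sum_of_bool_mult[OF fin(2)])
    qed
    finally show ?thesis unfolding meet_def by (simp add: eq_commute)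
  qed
  have "(\<Sum>p\<in>npairs V. (hits E p)\<^sup>2) =
      (\<Sum>p\<in>npairs V. \<Sum>e\<in>npairs E. \<Sum>e'\<in>npairs E. ?k e p * ?k e' p)"
    unfolding hits_def power2_eq_square by (simp only: sum_product)
  also have "\<dots> = (\<Sum>e\<in>npairs E. \<Sum>p\<in>npairs V. \<Sum>e'\<in>npairs E. ?k e p * ?k e' p)"
    by (rule sum.swap)
  also have "\<dots> = (\<Sum>e\<in>npairs E. \<Sum>e'\<in>npairs E. \<Sum>p\<in>npairs V. ?k e p * ?k e' p)"
    by (intro sum.cong refl sum.swap)
  also have "\<dots> = (\<Sum>e\<in>npairs E. \<Sum>e'\<in>npairs E. meet e e')"
    by (intro sum.cong refl meet)
  also have "\<dots> \<le> (\<Sum>e\<in>npairs E. \<Sum>e'\<in>npairs E.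
      of_bool (e = e') * real (card L) + real (q + 1) * of_bool (dst2 e = dst2 e'))"
    using npairs_mono[OF EV] by (intro sum_mono meet_le) auto
  also have "\<dots> = (\<Sum>e\<in>npairs E. \<Sum>e'\<in>npairs E. of_bool (e = e') * real (card L))
      + real (q + 1) * same_dst E"
    unfolding same_dst_def sum.distrib sum_distrib_left ..
  also have "(\<Sum>e\<in>npairs E. \<Sum>e'\<in>npairs E. of_bool (e = e') * real (card L)) =
      (\<Sum>e\<in>npairs E. real (card L))"
    by (intro sum.cong refl sum_of_bool_mult fin)
  finally show ?thesis by (simp add: mult.commute)
qed

lemma sum_avg_hits: "(\<Sum>e\<in>npairs E. avg_hits E e) = same_dst E / real q"
  unfolding avg_hits_def same_dst_def by (simp add: sum_divide_distrib eq_commute)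

text \<open>\<open>avg_hits\<close> sees only the distance of a pair, which reflections preserve, so
  each of the \<open>q (q + 1)\<close> images of \<open>e\<close> contributes
  \<open>avg_hits E e\<close>. One factor \<open>q\<close> cancels against the normalisation of
  \<open>avg_hits\<close>.\<close>

lemma sum_hits_avg:
  "(\<Sum>p\<in>npairs V. hits E p * avg_hits E p) = real (q + 1) * same_dst E"
proof -
  note fin = finite_npairs[OF EV] finite_npairs[OF order_refl]
  have "(\<Sum>p\<in>npairs V. hits E p * avg_hits E p) =
      (\<Sum>p\<in>npairs V. \<Sum>e\<in>npairs E. \<Sum>l\<in>L. of_bool (mir2 l e = p) * avg_hits E p)"
    unfolding hits_def by (simp add: sum_distrib_right)
  also have "\<dots> = (\<Sum>e\<in>npairs E. \<Sum>p\<in>npairs V. \<Sum>l\<in>L. of_bool (mir2 l e = p) * avg_hits E p)"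
    by (rule sum.swap)
  also have "\<dots> = (\<Sum>e\<in>npairs E. \<Sum>l\<in>L. \<Sum>p\<in>npairs V. of_bool (mir2 l e = p) * avg_hits E p)"
    by (intro sum.cong refl sum.swap)
  also have "\<dots> = (\<Sum>e\<in>npairs E. \<Sum>l\<in>L. avg_hits E e)"
  proof (intro sum.cong refl)
    fix e l assume "e \<in> npairs E" "l \<in> L"
    then have *: "mir2 l e \<in> npairs V" "dst2 (mir2 l e) = dst2 e"
      using mir2_closed npairs_mono[OF EV] mir2_isometry by blast+
    have "(\<Sum>p\<in>npairs V. of_bool (mir2 l e = p) * avg_hits E p) = avg_hits E (mir2 l e)"
      by (rule sum_of_bool_mult[OF fin(2) *(1)])
    also have "\<dots> = avg_hits E e" unfolding avg_hits_def *(2) ..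
    finally show "(\<Sum>p\<in>npairs V. of_bool (mir2 l e = p) * avg_hits E p) = avg_hits E e" .
  qed
  also have "\<dots> = real (card L) * (\<Sum>e\<in>npairs E. avg_hits E e)"
    by (simp add: sum_distrib_left)
  finally have "(\<Sum>p\<in>npairs V. hits E p * avg_hits E p) =
      real (card L) * (\<Sum>e\<in>npairs E. avg_hits E e)" .
  moreover note sum_avg_hits
  moreover have "real (card L) = real q * real (q + 1)" unfolding card_L by (rule of_nat_mult)
  ultimately show ?thesis using q_pos by simp
qed

text \<open>After expanding the square, a pair \<open>e\<close>, \<open>e'\<close> contributes only
  if their distances agree, and then at most \<open>q^2 (q + 1)\<close> pairs \<open>p\<close> share
  that distance; the \<open>q^2\<close> cancels against the normalisation.\<close>

lemma sum_avg_sq: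
  "(\<Sum>p\<in>npairs V. (avg_hits E p)\<^sup>2) \<le> real (q + 1) * same_dst E"
proof -
  note fin = finite_npairs[OF EV] finite_npairs[OF order_refl]
  have "(real q)\<^sup>2 * (\<Sum>p\<in>npairs V. (avg_hits E p)\<^sup>2) =
      (\<Sum>p\<in>npairs V. (\<Sum>e\<in>npairs E. of_bool (dst2 e = dst2 p))\<^sup>2)"
    unfolding avg_hits_def using q_pos by (simp add: sum_distrib_left power_divide)
  also have "\<dots> = (\<Sum>p\<in>npairs V. \<Sum>e\<in>npairs E. \<Sum>e'\<in>npairs E. of_bool (dst2 e = dst2 p) * of_bool (dst2 e' = dst2 p))"
    unfolding power2_eq_square by (simp only: sum_product)
  also have "\<dots> = (\<Sum>e\<in>npairs E. \<Sum>p\<in>npairs V. \<Sum>e'\<in>npairs E. of_bool (dst2 e = dst2 p) * of_bool (dst2 e' = dst2 p))"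
    by (rule sum.swap)
  also have "\<dots> = (\<Sum>e\<in>npairs E. \<Sum>e'\<in>npairs E. \<Sum>p\<in>npairs V. of_bool (dst2 e = dst2 p) * of_bool (dst2 e' = dst2 p))"
    by (intro sum.cong refl sum.swap)
  also have "\<dots> \<le> (\<Sum>e\<in>npairs E. \<Sum>e'\<in>npairs E. real (q\<^sup>2 * (q + 1)) * of_bool (dst2 e = dst2 e'))"
  proof (intro sum_mono)
    fix e e' :: "'v \<times> 'v"
    have "(\<Sum>p\<in>npairs V. of_bool (dst2 e = dst2 p) * of_bool (dst2 e' = dst2 p)) =
      (of_bool (dst2 e = dst2 e') :: real) * (\<Sum>p\<in>npairs V. of_bool (dst2 p = dst2 e))"
      by (subst sum_distrib_left) (intro sum.cong refl, auto)
    also have "(\<Sum>p\<in>npairs V. of_bool (dst2 p = dst2 e)) = real (card {p \<in> npairs V. dst2 p = dst2 e})"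
      using fin(2) by (simp add: sum_of_bool_eq Int_def)
    also have "of_bool (dst2 e = dst2 e') * \<dots> \<le> of_bool (dst2 e = dst2 e') * real (q\<^sup>2 * (q + 1))"
      by (intro mult_left_mono of_nat_mono card_npairs_dst) simp
    finally show "(\<Sum>p\<in>npairs V. of_bool (dst2 e = dst2 p) * of_bool (dst2 e' = dst2 p)) \<le>
        real (q\<^sup>2 * (q + 1)) * of_bool (dst2 e = dst2 e')" by (simp add: mult.commute)
  qed
  also have "\<dots> = (real q)\<^sup>2 * (real (q + 1) * same_dst E)"
    unfolding same_dst_def by (simp add: sum_distrib_left algebra_simps)
  finally show ?thesis using q_pos by (simp add: mult_le_cancel_left)
qed

text \<open>The multiples of \<open>same_dst E\<close> cancel: \<open>q + 1\<close> from each of the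
  two squares against \<open>2 (q + 1)\<close> from the cross term. Only the diagonal contribution
  of \<open>sum_hits_sq\<close> survives.\<close>

lemma hits_variance:
  "(\<Sum>p\<in>npairs V. (hits E p - avg_hits E p)\<^sup>2) \<le> real (card L) * real (card (npairs E))"
proof -
  have "(\<Sum>p\<in>npairs V. (hits E p - avg_hits E p)\<^sup>2) =
      (\<Sum>p\<in>npairs V. (hits E p)\<^sup>2) + (\<Sum>p\<in>npairs V. (avg_hits E p)\<^sup>2)
        - 2 * (\<Sum>p\<in>npairs V. hits E p * avg_hits E p)"
    by (simp add: power2_diff sum.distrib sum_subtractf sum_distrib_left mult.assoc)
  with sum_hits_sq sum_hits_avg sum_avg_sq show ?thesis by linarith
qed

lemma card_npairs_le: "real (card (npairs E)) \<le> (real (card E))\<^sup>2"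
proof -
  have "card (npairs E) \<le> card (E \<times> E)"
    unfolding npairs_def using EV finite_V by (intro card_mono) (auto intro: finite_subset)
  then show ?thesis by (simp add: card_cartesian_product power2_eq_square flip: of_nat_mult)
qed

text \<open>Cauchy-Schwarz over the pairs of \<open>E\<close>, after enlarging the variance to all
  of \<open>npairs V\<close>. The average part sums to \<open>same_dst E / q\<close>.\<close>

lemma sum_hits_le:
  "(\<Sum>e\<in>npairs E. hits E e) \<le> same_dst E / real q + 2 * real q * (real (card E))\<^sup>2"
proof -
  note fin = finite_npairs[OF EV] finite_npairs[OF order_refl]
  let ?d = "\<lambda>e. hits E e - avg_hits E e"
  have "(\<Sum>e\<in>npairs E. ?d e)\<^sup>2 \<le> (\<Sum>e\<in>npairs E. (?d e)\<^sup>2) * card (npairs E)"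
    by (rule sum_squared_le_sum_of_squares)
  also have "\<dots> \<le> (\<Sum>e\<in>npairs V. (?d e)\<^sup>2) * card (npairs E)"
    using fin npairs_mono[OF EV] by (intro mult_right_mono sum_mono2) auto
  also have "\<dots> \<le> real (card L) * real (card (npairs E)) * card (npairs E)"
    by (intro mult_right_mono hits_variance) auto
  \<comment> \<open>Bounding \<open>q (q + 1)\<close> by \<open>(2 q)^2\<close> gives a perfect
    square; this is the origin of the constant 2.\<close>
  also have "\<dots> \<le> (2 * real q * real (card (npairs E)))\<^sup>2"
  proof -
    have "q * (q + 1) \<le> (2 * q)\<^sup>2" using q_pos by (simp add: power2_eq_square)
    then have "real (card L) \<le> (2 * real q)\<^sup>2" unfolding card_L
      by (metis of_nat_le_iff of_nat_mult of_nat_numeral of_nat_power)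
    then have "real (card L) * (real (card (npairs E)))\<^sup>2 \<le> (2 * real q)\<^sup>2 * (real (card (npairs E)))\<^sup>2"
      by (intro mult_right_mono) auto
    then show ?thesis by (simp add: power_mult_distrib power2_eq_square mult_ac)
  qed
  finally have "(\<Sum>e\<in>npairs E. ?d e) \<le> 2 * real q * real (card (npairs E))"
    by (rule power2_le_imp_le) simp
  also have "\<dots> \<le> 2 * real q * (real (card E))\<^sup>2"
    using card_npairs_le by (intro mult_left_mono) auto
  finally show ?thesis using sum_avg_hits by (simp add: sum_subtractf)
qed

section \<open>Point-axis incidences and bisector energy\<close>

definition inc :: "'l \<Rightarrow> real" where
  "inc l = (\<Sum>x\<in>E. of_bool (mir l x = x))"

text \<open>The sum of its squares over \<open>L\<close> is the bisector energy of
  \<open>E\<close>.\<close>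

definition bis :: "'l \<Rightarrow> real" where
  "bis l = (\<Sum>y\<in>E. \<Sum>z\<in>E. of_bool (y \<noteq> z \<and> mir l y = z))"

lemma finite_E: "finite E"
  using EV finite_V by (rule finite_subset)

lemma sum_fixing: "x \<in> E \<Longrightarrow> (\<Sum>l\<in>L. of_bool (mir l x = x)) = real (q + 1)"
  using card_lines_through[of x] EV finite_L
  by (auto simp add: sum_of_bool_eq Int_def)

lemma sum_bis: "(\<Sum>l\<in>L. bis l) \<le> (real (card E))\<^sup>2"
proof -
  have "(\<Sum>l\<in>L. bis l) = (\<Sum>y\<in>E. \<Sum>l\<in>L. \<Sum>z\<in>E. of_bool (y \<noteq> z \<and> mir l y = z))"
    unfolding bis_def by (rule sum.swap)
  also have "\<dots> = (\<Sum>y\<in>E. \<Sum>z\<in>E. \<Sum>l\<in>L. of_bool (y \<noteq> z \<and> mir l y = z))"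
    by (intro sum.cong refl sum.swap)
  also have "\<dots> \<le> (\<Sum>y\<in>E. \<Sum>z\<in>E. 1)"
  proof (intro sum_mono)
    fix y z assume "y \<in> E" "z \<in> E"
    then have "y \<noteq> z \<Longrightarrow> (\<Sum>l\<in>L. of_bool (mir l y = z)) = (1::real)"
      using EV by (intro sum_of_bool_ex1 finite_L ex1_bisector) auto
    then show "(\<Sum>l\<in>L. of_bool (y \<noteq> z \<and> mir l y = z)) \<le> (1::real)" by (cases "y = z") auto
  qed
  finally show ?thesis by (simp add: power2_eq_square)
qed

text \<open>Both moments are computed exactly from the \<open>q + 1\<close> lines through a point
  and the single line through two points. There are \<open>q (q + 1)\<close> lines, so the mean of
  \<open>inc\<close> is \<open>card E / q\<close>; the variance sum is \<open>q m - m^2 / q\<close>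
  with \<open>m = card E\<close>.\<close>

lemma inc_variance: "(\<Sum>l\<in>L. (inc l - card E / q)\<^sup>2) \<le> real q * real (card E)"
proof -
  have s1: "(\<Sum>l\<in>L. inc l) = real (q + 1) * card E"
  proof -
    have "(\<Sum>l\<in>L. inc l) = (\<Sum>x\<in>E. \<Sum>l\<in>L. of_bool (mir l x = x))"
      unfolding inc_def by (rule sum.swap)
    also have "\<dots> = (\<Sum>x\<in>E. real (q + 1))" by (intro sum.cong refl sum_fixing)
    finally show ?thesis by (simp add: algebra_simps)
  qed
  have "(\<Sum>l\<in>L. (inc l)\<^sup>2) = (\<Sum>l\<in>L. \<Sum>x\<in>E. \<Sum>y\<in>E. of_bool (mir l x = x \<and> mir l y = y))"
    unfolding inc_def power2_eq_square by (simp add: sum_product flip: of_bool_conj)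
  also have "\<dots> = (\<Sum>x\<in>E. \<Sum>l\<in>L. \<Sum>y\<in>E. of_bool (mir l x = x \<and> mir l y = y))"
    by (rule sum.swap)
  also have "\<dots> = (\<Sum>x\<in>E. \<Sum>y\<in>E. \<Sum>l\<in>L. of_bool (mir l x = x \<and> mir l y = y))"
    by (intro sum.cong refl sum.swap)
  also have "\<dots> = (\<Sum>x\<in>E. \<Sum>y\<in>E. 1 + of_bool (y = x) * real q)"
  proof (intro sum.cong refl)
    fix x y assume xy: "x \<in> E" "y \<in> E"
    then have "x \<noteq> y \<Longrightarrow> (\<Sum>l\<in>L. of_bool (mir l x = x \<and> mir l y = y)) = (1::real)"
      using EV by (intro sum_of_bool_ex1 finite_L ex1_line) auto
    then show "(\<Sum>l\<in>L. of_bool (mir l x = x \<and> mir l y = y)) = (1::real) + of_bool (y = x) * real q"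
      using sum_fixing[OF xy(1)] by (cases "x = y") auto
  qed
  also have "\<dots> = (real (card E))\<^sup>2 + real q * real (card E)"
    using finite_E by (simp add: sum.distrib sum_of_bool_mult power2_eq_square algebra_simps cong: sum.cong)
  finally have s2: "(\<Sum>l\<in>L. (inc l)\<^sup>2) = (real (card E))\<^sup>2 + real q * real (card E)" .
  have "(\<Sum>l\<in>L. (inc l - card E / q)\<^sup>2) =
    (\<Sum>l\<in>L. (inc l)\<^sup>2) - 2 * (card E / q) * (\<Sum>l\<in>L. inc l) + real (card L) * (card E / q)\<^sup>2"
    by (simp add: power2_diff sum.distrib sum_subtractf sum_distrib_left sum_divide_distrib mult_ac)
  also have "\<dots> = real q * real (card E) - (real (card E))\<^sup>2 / q"
    unfolding s1 s2 card_L using q_pos by (simp add: field_simps power2_eq_square)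
  finally show ?thesis by simp
qed

text \<open>The square of \<open>bis l\<close> is at most the number of pairs of points of
  \<open>E\<close> that \<open>l\<close> maps into \<open>E\<close>. Pairs of distinct points give
  \<open>hits\<close>, because reflections are involutions. Pairs of equal points give the last two
  terms: one reflection takes \<open>y\<close> to a different \<open>z\<close>, and
  \<open>q + 1\<close> fix \<open>y\<close>.\<close>

lemma sum_bis_sq:
  "(\<Sum>l\<in>L. (bis l)\<^sup>2) \<le> same_dst E / real q + 2 * real q * (real (card E))\<^sup>2
     + (real (card E))\<^sup>2 + real q * real (card E)"
proof -
  note fin = finite_npairs[OF EV] finite_npairs[OF order_refl]
  let ?g = "\<lambda>e. \<Sum>l\<in>L. of_bool (mir l (fst e) \<in> E \<and> mir l (snd e) \<in> E) :: real"
  have bis_le: "bis l \<le> (\<Sum>y\<in>E. of_bool (mir l y \<in> E))" for l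
    unfolding bis_def
  proof (intro sum_mono)
    fix y
    have "(\<Sum>z\<in>E. of_bool (y \<noteq> z \<and> mir l y = z)) \<le> (\<Sum>z\<in>E. of_bool (z = mir l y) :: real)"
      by (intro sum_mono) auto
    also have "\<dots> = of_bool (mir l y \<in> E)" using finite_E by (simp add: of_bool_def)
    finally show "(\<Sum>z\<in>E. of_bool (y \<noteq> z \<and> mir l y = z)) \<le> (of_bool (mir l y \<in> E) :: real)" .
  qed
  have "bis l \<ge> 0" for l unfolding bis_def by (intro sum_nonneg) auto
  then have "(\<Sum>l\<in>L. (bis l)\<^sup>2) \<le> (\<Sum>l\<in>L. (\<Sum>y\<in>E. of_bool (mir l y \<in> E))\<^sup>2)"
    by (intro sum_mono power_mono bis_le)
  also have "\<dots> = (\<Sum>l\<in>L. \<Sum>y\<in>E. \<Sum>z\<in>E. of_bool (mir l y \<in> E \<and> mir l z \<in> E))"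
    unfolding power2_eq_square by (simp add: sum_product flip: of_bool_conj)
  also have "\<dots> = (\<Sum>l\<in>L. \<Sum>e\<in>E\<times>E. of_bool (mir l (fst e) \<in> E \<and> mir l (snd e) \<in> E))"
    by (simp add: sum.cartesian_product case_prod_beta)
  also have "\<dots> = (\<Sum>e\<in>E\<times>E. ?g e)" by (rule sum.swap)
  also have "\<dots> = (\<Sum>e\<in>npairs E. ?g e) + (\<Sum>e\<in>(\<lambda>y. (y, y)) ` E. ?g e)"
  proof -
    have "E \<times> E = npairs E \<union> (\<lambda>y. (y, y)) ` E" unfolding npairs_def by auto
    moreover have "npairs E \<inter> (\<lambda>y. (y, y)) ` E = {}" unfolding npairs_def by auto
    ultimately show ?thesis using fin(1) finite_E by (simp add: sum.union_disjoint)
  qed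
  also have "(\<Sum>e\<in>npairs E. ?g e) = (\<Sum>e\<in>npairs E. hits E e)"
  proof (intro sum.cong refl)
    fix e assume e: "e \<in> npairs E"
    then have eV: "e \<in> npairs V" using npairs_mono[OF EV] by blast
    have "hits E e = (\<Sum>l\<in>L. \<Sum>e'\<in>npairs E. of_bool (mir2 l e' = e))"
      unfolding hits_def by (rule sum.swap)
    also have "\<dots> = ?g e"
    proof (intro sum.cong refl)
      fix l assume l: "l \<in> L"
      have "(\<Sum>e'\<in>npairs E. of_bool (mir2 l e' = e)) = (\<Sum>e'\<in>npairs E. of_bool (e' = mir2 l e) :: real)"
        using npairs_mono[OF EV] mir2_mir2[OF l] eV by (intro sum.cong refl) (auto simp: of_bool_def)
      also have "\<dots> = of_bool (mir2 l e \<in> npairs E)" using fin(1) by (simp add: of_bool_def)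
      also have "mir2 l e \<in> npairs E \<longleftrightarrow> mir l (fst e) \<in> E \<and> mir l (snd e) \<in> E"
        using mir2_closed[OF l eV] unfolding npairs_def mir2_def by auto
      finally show "(\<Sum>e'\<in>npairs E. of_bool (mir2 l e' = e)) =
          (of_bool (mir l (fst e) \<in> E \<and> mir l (snd e) \<in> E) :: real)" .
    qed
    finally show "?g e = hits E e" ..
  qed
  also have "(\<Sum>e\<in>(\<lambda>y. (y, y)) ` E. ?g e) = (\<Sum>y\<in>E. \<Sum>l\<in>L. of_bool (mir l y \<in> E))"
    by (subst sum.reindex) (auto simp: inj_on_def)
  also have "\<dots> = (\<Sum>y\<in>E. \<Sum>l\<in>L. \<Sum>z\<in>E. of_bool (mir l y = z))"
    using finite_E by (intro sum.cong refl) (simp add: of_bool_def)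
  also have "\<dots> = (\<Sum>y\<in>E. \<Sum>z\<in>E. \<Sum>l\<in>L. of_bool (mir l y = z))"
    by (intro sum.cong refl sum.swap)
  also have "\<dots> = (\<Sum>y\<in>E. \<Sum>z\<in>E. 1 + of_bool (z = y) * real q)"
  proof (intro sum.cong refl)
    fix x y assume xy: "x \<in> E" "y \<in> E"
    then have "x \<noteq> y \<Longrightarrow> (\<Sum>l\<in>L. of_bool (mir l x = y)) = (1::real)"
      using EV by (intro sum_of_bool_ex1 finite_L ex1_bisector) auto
    then show "(\<Sum>l\<in>L. of_bool (mir l x = y)) = (1::real) + of_bool (y = x) * real q"
      using sum_fixing[OF xy(1)] by (cases "x = y") auto
  qed
  also have "\<dots> = (real (card E))\<^sup>2 + real q * real (card E)"
    using finite_E by (simp add: sum.distrib sum_of_bool_mult power2_eq_square algebra_simps cong: sum.cong)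
  finally show ?thesis using sum_hits_le by linarith
qed

text \<open>For \<open>y = z\<close> every \<open>x\<close> counts, which gives the square term. For
  \<open>y \<noteq> z\<close> the apex \<open>x\<close> lies on the axis of the one reflection
  taking \<open>y\<close> to \<open>z\<close>.\<close>

lemma isosceles_le_bis_inc:
  "(\<Sum>y\<in>E. \<Sum>z\<in>E. \<Sum>x\<in>E. of_bool (dst x y = dst x z)) \<le> (real (card E))\<^sup>2 + (\<Sum>l\<in>L. bis l * inc l)"
proof -
  have "(\<Sum>x\<in>E. of_bool (dst x y = dst x z)) \<le>
      of_bool (z = y) * real (card E) + (\<Sum>l\<in>L. of_bool (y \<noteq> z \<and> mir l y = z) * inc l)"
    if yz: "y \<in> E" "z \<in> E" for y z
  proof (cases "y = z")
    case False
    then obtain l where l: "l \<in> L" "mir l y = z" "\<And>l'. l' \<in> L \<Longrightarrow> mir l' y = z \<Longrightarrow> l' = l"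
      using ex1_bisector[of y z] yz EV by blast
    have "y \<noteq> z \<and> mir l' y = z \<longleftrightarrow> l' = l" if "l' \<in> L" for l' using l False that by blast
    then have "(\<Sum>l\<in>L. of_bool (y \<noteq> z \<and> mir l y = z) * inc l) = (\<Sum>l'\<in>L. of_bool (l' = l) * inc l')"
      by (intro sum.cong refl) simp
    also have "\<dots> = inc l" by (intro sum_of_bool_mult finite_L l)
    also have "(\<Sum>x\<in>E. of_bool (dst x y = dst x z)) \<le> inc l"
      unfolding inc_def using equidistant_fixed[OF l(1), of _ y] l(2) False yz EV
      by (intro sum_mono) auto
    finally show ?thesis using False by simp
  qed simp
  then have "(\<Sum>y\<in>E. \<Sum>z\<in>E. \<Sum>x\<in>E. of_bool (dst x y = dst x z)) \<le>
      (\<Sum>y\<in>E. \<Sum>z\<in>E. of_bool (z = y) * real (card E) + (\<Sum>l\<in>L. of_bool (y \<noteq> z \<and> mir l y = z) * inc l))"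
    by (intro sum_mono)
  also have "\<dots> = (real (card E))\<^sup>2 + (\<Sum>y\<in>E. \<Sum>z\<in>E. \<Sum>l\<in>L. of_bool (y \<noteq> z \<and> mir l y = z) * inc l)"
    using finite_E by (simp add: sum.distrib sum_of_bool_mult power2_eq_square cong: sum.cong)
  also have "(\<Sum>y\<in>E. \<Sum>z\<in>E. \<Sum>l\<in>L. of_bool (y \<noteq> z \<and> mir l y = z) * inc l) =
      (\<Sum>y\<in>E. \<Sum>l\<in>L. \<Sum>z\<in>E. of_bool (y \<noteq> z \<and> mir l y = z) * inc l)"
    by (intro sum.cong refl sum.swap)
  also have "\<dots> = (\<Sum>l\<in>L. \<Sum>y\<in>E. \<Sum>z\<in>E. of_bool (y \<noteq> z \<and> mir l y = z) * inc l)"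
    by (rule sum.swap)
  also have "\<dots> = (\<Sum>l\<in>L. bis l * inc l)"
    unfolding bis_def by (simp add: sum_distrib_right)
  finally show ?thesis .
qed

text \<open>In the sum of \<open>bis l * inc l\<close>, write \<open>inc l\<close> as its mean plus
  a deviation. By \<open>sum_bis\<close> the mean contributes at most \<open>m^3 / q\<close>; the
  deviation is handled by Cauchy-Schwarz from \<open>sum_bis_sq\<close> and
  \<open>inc_variance\<close>.\<close>

theorem isosceles_bound:
  "(\<Sum>y\<in>E. \<Sum>z\<in>E. \<Sum>x\<in>E. of_bool (dst x y = dst x z)) - real (card E) ^ 3 / q
    \<le> (real (card E))\<^sup>2 + sqrt (real q * real (card E)) *
      sqrt (same_dst E / real q + 2 * real q * (real (card E))\<^sup>2 + (real (card E))\<^sup>2 + real q * real (card E))"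
proof -
  let ?m = "real (card E)"
  let ?B = "same_dst E / real q + 2 * real q * ?m\<^sup>2 + ?m\<^sup>2 + real q * ?m"
  have "(\<Sum>l\<in>L. bis l * (inc l - ?m / q))\<^sup>2 \<le> (\<Sum>l\<in>L. (bis l)\<^sup>2) * (\<Sum>l\<in>L. (inc l - ?m / q)\<^sup>2)"
    by (rule Cauchy_Schwarz_ineq_sum)
  also have "\<dots> \<le> ?B * (real q * ?m)"
    using sum_bis_sq order_trans[OF sum_nonneg sum_bis_sq]
    by (intro mult_mono inc_variance sum_bis_sq sum_nonneg) auto
  finally have "(\<Sum>l\<in>L. bis l * (inc l - ?m / q)) \<le> sqrt (?B * (real q * ?m))"
    by (rule real_le_rsqrt)
  moreover have "(\<Sum>l\<in>L. bis l * inc l) = (\<Sum>l\<in>L. bis l * (inc l - ?m / q)) + ?m / q * (\<Sum>l\<in>L. bis l)"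
    by (simp add: algebra_simps sum_subtractf sum_distrib_left sum_divide_distrib)
  moreover have "?m / q * (\<Sum>l\<in>L. bis l) \<le> ?m / q * ?m\<^sup>2"
    by (intro mult_left_mono sum_bis) auto
  moreover have "?m / q * ?m\<^sup>2 = ?m ^ 3 / q" by (simp add: power2_eq_square power3_eq_cube)
  moreover have "sqrt (?B * (real q * ?m)) = sqrt (real q * ?m) * sqrt ?B"
    by (simp only: real_sqrt_mult mult.commute)
  ultimately show ?thesis
    using isosceles_le_bis_inc by linarith
qed

end
end

subsection \<open>Reflections in the plane over a field of order 3 modulo 4\<close>

text \<open>The residue 3 modulo 4 is used twice: the order is odd, so doubling is injective, and
  \<open>-1\<close> is not a square, so no nonzero vector has norm zero.\<close>

locale plane_field = field R for R (structure) +
  assumes finite_carrier: "finite (carrier R)" and order_mod_4: "order R mod 4 = 3"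
begin

text \<open>The additive order of \<open>a\<close> divides both 2 and the odd order of the
  field.\<close>

lemma add_self_eq_zero:
  assumes a: "a \<in> carrier R" and eq: "a \<oplus> a = \<zero>"
  shows "a = \<zero>"
proof -
  let ?ord = "group.ord (add_monoid R) a"
  have "a [^]\<^bsub>add_monoid R\<^esub> (2::nat) = \<one>\<^bsub>add_monoid R\<^esub>"
    using a eq by (simp add: numeral_2_eq_2)
  then have "?ord dvd 2" using group.pow_eq_id[OF a_group] a by simp
  moreover have "?ord dvd order R"
    using group.ord_dvd_group_order[OF a_group, of a] a unfolding order_def by simp
  moreover have "odd (order R)" using order_mod_4 by presburger
  ultimately have "?ord dvd 2" "odd ?ord" using dvd_trans by blast+
  then have "?ord \<noteq> 0" "?ord \<noteq> 2" "?ord \<le> 2" by (auto dest: dvd_imp_le)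
  then have "?ord = 1" by linarith
  then show ?thesis using group.ord_eq_1[OF a_group, of a] a by simp
qed

text \<open>For order \<open>4 m + 3\<close>, raising a nonzero \<open>c\<close> to the power
  \<open>2 (2 m + 1)\<close> gives one, whereas a square root of \<open>-1\<close> would give an odd
  power of \<open>-1\<close>.\<close>

lemma minus_one_not_square:
  assumes c: "c \<in> carrier R" shows "c \<otimes> c \<noteq> \<ominus> \<one>"
proof
  assume eq: "c \<otimes> c = \<ominus> \<one>"
  then have "c \<noteq> \<zero>" by (metis add.inv_eq_1_iff l_null one_closed one_not_zero c)
  define m where "m = order R div 4"
  have ord: "order R = 4 * m + 3" unfolding m_def using order_mod_4 by presburger
  have "c [^] (order R - 1) = \<one>"
    using units_power_order_eq_one[of c] c \<open>c \<noteq> \<zero>\<close> finite_carrier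
    by (simp add: field_Units order_def)
  moreover have "order R - 1 = 2 * (2 * m + 1)" using ord by simp
  ultimately have "(c [^] (2::nat)) [^] (2 * m + 1) = \<one>" using c by (simp only: nat_pow_pow)
  then have "(\<ominus> \<one>) [^] (2 * m + 1) = \<one>" using eq c by (simp add: numeral_2_eq_2)
  moreover have "(\<ominus> \<one>) [^] (2 * m + 1) = \<ominus> \<one>"
  proof -
    have "(\<ominus> \<one>) [^] (2::nat) = \<one>" by (simp add: numeral_2_eq_2 l_minus)
    then have "(\<ominus> \<one>) [^] (2 * m) = \<one>" by (simp flip: nat_pow_pow)
    then show ?thesis by simp
  qed
  ultimately have "\<ominus> \<one> = \<one>" by simp
  then have "\<one> \<oplus> \<one> = \<zero>" by (metis l_neg one_closed)
  then show False using add_self_eq_zero[of \<one>] by simp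
qed

text \<open>If \<open>b\<close> were nonzero, \<open>a / b\<close> would be a square root of
  \<open>-1\<close>.\<close>

lemma sum_squares_eq_zero:
  assumes a: "a \<in> carrier R" and b: "b \<in> carrier R" and eq: "a \<otimes> a \<oplus> b \<otimes> b = \<zero>"
  shows "a = \<zero> \<and> b = \<zero>"
proof (cases "b = \<zero>")
  case True
  then show ?thesis using eq a by (simp add: integral_iff)
next
  case False
  then have U: "b \<in> Units R" using b by (simp add: field_Units)
  then have i: "inv b \<in> carrier R" "b \<otimes> inv b = \<one>" by simp_all
  have "(a \<otimes> inv b) \<otimes> (a \<otimes> inv b) \<oplus> (b \<otimes> inv b) \<otimes> (b \<otimes> inv b) =
      (a \<otimes> a \<oplus> b \<otimes> b) \<otimes> (inv b \<otimes> inv b)"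
    using a b i(1) by algebra
  then have "(a \<otimes> inv b) \<otimes> (a \<otimes> inv b) \<oplus> \<one> = \<zero>" using eq a b i by simp
  then have "(a \<otimes> inv b) \<otimes> (a \<otimes> inv b) = \<ominus> \<one>"
    using a i by (metis m_closed minus_equality one_closed)
  then show ?thesis using minus_one_not_square[of "a \<otimes> inv b"] a i by simp
qed

section \<open>Inner products, cross products and directions\<close>

definition plane :: "('a \<times> 'a) set" where "plane = carrier R \<times> carrier R"

lemma mem_plane [simp]: "(a, b) \<in> plane \<longleftrightarrow> a \<in> carrier R \<and> b \<in> carrier R"
  unfolding plane_def by simp

definition dot :: "'a \<times> 'a \<Rightarrow> 'a \<times> 'a \<Rightarrow> 'a" where
  "dot u v = fst u \<otimes> fst v \<oplus> snd u \<otimes> snd v"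

definition cross :: "'a \<times> 'a \<Rightarrow> 'a \<times> 'a \<Rightarrow> 'a" where
  "cross u v = fst u \<otimes> snd v \<ominus> snd u \<otimes> fst v"

definition vdiff :: "'a \<times> 'a \<Rightarrow> 'a \<times> 'a \<Rightarrow> 'a \<times> 'a" where
  "vdiff u v = (fst u \<ominus> fst v, snd u \<ominus> snd v)"

definition vsum :: "'a \<times> 'a \<Rightarrow> 'a \<times> 'a \<Rightarrow> 'a \<times> 'a" where
  "vsum u v = (fst u \<oplus> fst v, snd u \<oplus> snd v)"

text \<open>One representative for each point of the projective line, so that every axis has exactly
  one normal.\<close>

definition normals :: "('a \<times> 'a) set" where
  "normals = insert (\<zero>, \<one>) ((\<lambda>m. (\<one>, m)) ` carrier R)"

lemma plane_components [simp]: "u \<in> plane \<Longrightarrow> fst u \<in> carrier R" "u \<in> plane \<Longrightarrow> snd u \<in> carrier R"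
  unfolding plane_def by auto

lemma dot_closed [simp]: "u \<in> plane \<Longrightarrow> v \<in> plane \<Longrightarrow> dot u v \<in> carrier R"
  unfolding dot_def by simp

lemma cross_closed [simp]: "u \<in> plane \<Longrightarrow> v \<in> plane \<Longrightarrow> cross u v \<in> carrier R"
  unfolding cross_def by simp

lemma vdiff_closed [simp]: "u \<in> plane \<Longrightarrow> v \<in> plane \<Longrightarrow> vdiff u v \<in> plane"
  unfolding vdiff_def by auto

lemma vsum_closed [simp]: "u \<in> plane \<Longrightarrow> v \<in> plane \<Longrightarrow> vsum u v \<in> plane"
  unfolding vsum_def by auto

lemma normals_closed: "n \<in> normals \<Longrightarrow> n \<in> plane"
  unfolding normals_def by auto

lemma card_normals: "card normals = order R + 1"
  unfolding normals_def order_def using finite_carrier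
  by (subst card_insert_disjoint) (auto simp: card_image inj_on_def)

lemma dot_vdiff: "n \<in> plane \<Longrightarrow> u \<in> plane \<Longrightarrow> v \<in> plane \<Longrightarrow> dot n (vdiff u v) = dot n u \<ominus> dot n v"
  unfolding dot_def vdiff_def fst_conv snd_conv
  using plane_components[of n] plane_components[of u] plane_components[of v] by algebra

lemma cross_vdiff: "n \<in> plane \<Longrightarrow> u \<in> plane \<Longrightarrow> v \<in> plane \<Longrightarrow> cross n (vdiff u v) = cross n u \<ominus> cross n v"
  unfolding cross_def vdiff_def fst_conv snd_conv
  using plane_components[of n] plane_components[of u] plane_components[of v] by algebra

lemma dot_vsum: "n \<in> plane \<Longrightarrow> u \<in> plane \<Longrightarrow> v \<in> plane \<Longrightarrow> dot n (vsum u v) = dot n u \<oplus> dot n v"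
  unfolding dot_def vsum_def fst_conv snd_conv
  using plane_components[of n] plane_components[of u] plane_components[of v] by algebra

lemma vdiff_eq_zero_iff: "u \<in> plane \<Longrightarrow> v \<in> plane \<Longrightarrow> vdiff u v = (\<zero>, \<zero>) \<longleftrightarrow> u = v"
  unfolding vdiff_def by (simp add: r_right_minus_eq prod_eq_iff)

lemma vdiff_left_cancel:
  assumes x: "x \<in> plane" and y: "y \<in> plane" and z: "z \<in> plane" and eq: "vdiff x y = vdiff x z"
  shows "y = z"
proof -
  have "b = c" if "a \<in> carrier R" "b \<in> carrier R" "c \<in> carrier R" "a \<ominus> b = a \<ominus> c" for a b c
    using that by (metis a_inv_closed add.l_cancel minus_eq minus_minus)
  then show ?thesis using assms plane_components unfolding vdiff_def by (metis Pair_inject prod_eqI)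
qed

lemma sqdist_eq_dot: "x \<in> plane \<Longrightarrow> y \<in> plane \<Longrightarrow> sqdist R x y = dot (vdiff x y) (vdiff x y)"
  unfolding sqdist_def dot_def vdiff_def by (simp add: numeral_2_eq_2)

lemma sqdist_closed: "x \<in> plane \<Longrightarrow> y \<in> plane \<Longrightarrow> sqdist R x y \<in> carrier R"
  by (simp add: sqdist_eq_dot)

lemma dot_self_diff:
  assumes "u \<in> plane" "v \<in> plane"
  shows "dot u u \<ominus> dot v v = dot (vdiff u v) (vsum u v)"
proof -
  have sq: "a \<otimes> a \<ominus> b \<otimes> b = (a \<ominus> b) \<otimes> (a \<oplus> b)" if "a \<in> carrier R" "b \<in> carrier R" for a b
    using that by algebra
  have swap: "(a \<oplus> b) \<ominus> (c \<oplus> d) = (a \<ominus> c) \<oplus> (b \<ominus> d)"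
    if "a \<in> carrier R" "b \<in> carrier R" "c \<in> carrier R" "d \<in> carrier R" for a b c d
    using that by algebra
  show ?thesis using assms unfolding dot_def vdiff_def vsum_def by (simp add: swap sq)
qed

lemma normal_nonzero: "n \<in> normals \<Longrightarrow> n \<noteq> (\<zero>, \<zero>)"
  unfolding normals_def by auto

lemma dot_self_nonzero:
  assumes "u \<in> plane" "u \<noteq> (\<zero>, \<zero>)" shows "dot u u \<noteq> \<zero>"
  using assms sum_squares_eq_zero[of "fst u" "snd u"] unfolding dot_def by (auto simp: prod_eq_iff)

text \<open>Since \<open>n\<close> has nonzero norm, \<open>dot n\<close> and \<open>cross n\<close>
  serve as coordinates on the plane: both components of \<open>w\<close> times
  \<open>dot n n\<close> are combinations of them.\<close>

lemma dot_cross_unique: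
  assumes n: "n \<in> normals" and w: "w \<in> plane" and "dot n w = \<zero>" "cross n w = \<zero>"
  shows "w = (\<zero>, \<zero>)"
proof -
  note N = normals_closed[OF n]
  have "fst w \<otimes> dot n n = fst n \<otimes> dot n w \<ominus> snd n \<otimes> cross n w"
    unfolding dot_def cross_def using plane_components[OF N] plane_components[OF w] by algebra
  moreover have "snd w \<otimes> dot n n = snd n \<otimes> dot n w \<oplus> fst n \<otimes> cross n w"
    unfolding dot_def cross_def using plane_components[OF N] plane_components[OF w] by algebra
  ultimately have "fst w \<otimes> dot n n = \<zero>" "snd w \<otimes> dot n n = \<zero>"
    using assms N by (simp_all add: minus_eq)
  then show ?thesis
    using dot_self_nonzero[OF N normal_nonzero[OF n]] w N by (simp add: prod_eq_iff integral_iff)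
qed

lemma dot_cross_inject:
  assumes n: "n \<in> normals" and "u \<in> plane" "v \<in> plane" "dot n u = dot n v" "cross n u = cross n v"
  shows "u = v"
  using dot_cross_unique[OF n, of "vdiff u v"] assms normals_closed[OF n]
  by (simp add: dot_vdiff cross_vdiff r_right_minus_eq vdiff_eq_zero_iff)

lemma normal_unique:
  assumes n: "n \<in> normals" "n' \<in> normals" and v: "v \<in> plane" "v \<noteq> (\<zero>, \<zero>)"
    and eq: "dot n v = \<zero>" "dot n' v = \<zero>"
  shows "n = n'"
proof -
  have vanish: "snd v = \<zero>" if "dot (\<zero>, \<one>) v = \<zero>"
    using that v(1) unfolding dot_def by simp
  have slope: "fst v = \<ominus> (m \<otimes> snd v)" if "dot (\<one>, m) v = \<zero>" "m \<in> carrier R" for m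
    using that v(1) minus_equality[of "fst v" "m \<otimes> snd v"] unfolding dot_def by simp
  have "m = m'" if m: "m \<in> carrier R" "m' \<in> carrier R" "dot (\<one>, m) v = \<zero>" "dot (\<one>, m') v = \<zero>" for m m'
  proof -
    have "snd v \<noteq> \<zero>" using slope[OF m(3,1)] v m(1) by (auto simp: prod_eq_iff)
    moreover have "m \<otimes> snd v = m' \<otimes> snd v"
      using slope[OF m(3,1)] slope[OF m(4,2)] m(1,2) v(1) by (metis m_closed minus_minus plane_components(2))
    ultimately show ?thesis using m(1,2) v(1) by (metis m_rcancel plane_components(2))
  qed
  moreover have False if "m \<in> carrier R" "dot (\<one>, m) v = \<zero>" "dot (\<zero>, \<one>) v = \<zero>" for m
    using slope[OF that(2,1)] vanish[OF that(3)] v that(1) by (auto simp: prod_eq_iff)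
  ultimately show ?thesis using n eq unfolding normals_def by blast
qed

lemma normal_exists:
  assumes v: "v \<in> plane"
  shows "\<exists>n\<in>normals. dot n v = \<zero>"
proof (cases "snd v = \<zero>")
  case True
  then have "dot (\<zero>, \<one>) v = \<zero>" using v unfolding dot_def by simp
  then show ?thesis unfolding normals_def by blast
next
  case False
  then have U: "snd v \<in> Units R" using v by (simp add: field_Units)
  let ?m = "\<ominus> (fst v \<otimes> inv (snd v))"
  have "?m \<otimes> snd v = \<ominus> fst v"
    using U v by (simp add: l_minus m_assoc)
  then have "dot (\<one>, ?m) v = \<zero>" using v unfolding dot_def by (simp add: r_neg)
  moreover have "(\<one>, ?m) \<in> normals" unfolding normals_def using U v by auto
  ultimately show ?thesis by blast
qed

text \<open>A quarter turn. It converts \<open>cross\<close> into \<open>dot\<close>, so facts on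
  perpendicular normals carry over to parallel ones.\<close>

definition turn :: "'a \<times> 'a \<Rightarrow> 'a \<times> 'a" where
  "turn v = (snd v, \<ominus> fst v)"

lemma turn_closed [simp]: "v \<in> plane \<Longrightarrow> turn v \<in> plane"
  unfolding turn_def by auto

lemma turn_nonzero: "v \<in> plane \<Longrightarrow> v \<noteq> (\<zero>, \<zero>) \<Longrightarrow> turn v \<noteq> (\<zero>, \<zero>)"
  unfolding turn_def by (auto simp: prod_eq_iff)

lemma cross_eq_dot_turn: "n \<in> plane \<Longrightarrow> v \<in> plane \<Longrightarrow> cross n v = dot n (turn v)"
  unfolding cross_def dot_def turn_def by (simp add: minus_eq r_minus)

lemma normal_unique_cross:
  assumes "n \<in> normals" "n' \<in> normals" "v \<in> plane" "v \<noteq> (\<zero>, \<zero>)" "cross n v = \<zero>" "cross n' v = \<zero>"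
  shows "n = n'"
  using normal_unique[OF assms(1,2) turn_closed[OF assms(3)] turn_nonzero[OF assms(3,4)]] assms
  by (simp add: cross_eq_dot_turn normals_closed)

lemma normal_exists_cross: "v \<in> plane \<Longrightarrow> \<exists>n\<in>normals. cross n v = \<zero>"
  using normal_exists[of "turn v"] by (metis cross_eq_dot_turn normals_closed turn_closed)

text \<open>Each coordinate of \<open>n\<close> times \<open>dot w s\<close> is a combination of the
  two vanishing quantities, and some coordinate of \<open>n\<close> is nonzero.\<close>

lemma parallel_perpendicular:
  assumes n: "n \<in> plane" "n \<noteq> (\<zero>, \<zero>)" and ws: "w \<in> plane" "s \<in> plane"
    and eq: "cross n w = \<zero>" "dot n s = \<zero>"
  shows "dot w s = \<zero>"
proof -
  note C = plane_components[OF n(1)] plane_components[OF ws(1)] plane_components[OF ws(2)]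
  have "fst n \<otimes> dot w s = fst w \<otimes> dot n s \<oplus> snd s \<otimes> cross n w"
    unfolding dot_def cross_def using C by algebra
  moreover have "snd n \<otimes> dot w s = snd w \<otimes> dot n s \<ominus> fst s \<otimes> cross n w"
    unfolding dot_def cross_def using C by algebra
  ultimately have "fst n \<otimes> dot w s = \<zero>" "snd n \<otimes> dot w s = \<zero>"
    using eq C by (simp_all add: minus_eq)
  then show ?thesis using n ws C by (auto simp: prod_eq_iff integral_iff)
qed

lemma cross_commute_zero:
  assumes "u \<in> plane" "v \<in> plane" "cross u v = \<zero>" shows "cross v u = \<zero>"
proof -
  note C = plane_components[OF assms(1)] plane_components[OF assms(2)]
  have "cross v u = \<ominus> cross u v"
    unfolding cross_def using C by algebra
  then show ?thesis using assms by simp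
qed

text \<open>A line is a pair \<open>(n, b)\<close> standing for \<open>{x. 2 n \<cdot> x = b}\<close>; the doubling makes the
  reflection condition \<open>n \<cdot> (y + z) = b\<close>, \<open>n \<times> y = n \<times> z\<close> free of divisions.\<close>

definition lines :: "(('a \<times> 'a) \<times> 'a) set" where
  "lines = normals \<times> carrier R"

definition reflect :: "('a \<times> 'a) \<times> 'a \<Rightarrow> 'a \<times> 'a \<Rightarrow> 'a \<times> 'a" where
  "reflect l y = (THE z. z \<in> plane \<and> dot (fst l) y \<oplus> dot (fst l) z = snd l \<and> cross (fst l) y = cross (fst l) z)"

lemma dot_cross_solve:
  assumes n: "n \<in> normals" and bc: "b \<in> carrier R" "c \<in> carrier R"
  shows "\<exists>z\<in>plane. dot n z = b \<and> cross n z = c"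
proof -
  note N = normals_closed[OF n]
  have U: "dot n n \<in> Units R"
    using dot_self_nonzero[OF N normal_nonzero[OF n]] N by (simp add: field_Units)
  define D where "D = inv (dot n n)"
  have D: "D \<in> carrier R" "dot n n \<otimes> D = \<one>" unfolding D_def using U by simp_all
  note C = plane_components[OF N] bc D(1)
  let ?z = "((fst n \<otimes> b \<ominus> snd n \<otimes> c) \<otimes> D, (snd n \<otimes> b \<oplus> fst n \<otimes> c) \<otimes> D)"
  have "dot n ?z = b \<otimes> (dot n n \<otimes> D)" "cross n ?z = c \<otimes> (dot n n \<otimes> D)"
    unfolding dot_def cross_def fst_conv snd_conv using C by algebra+
  then have "dot n ?z = b" "cross n ?z = c" using D bc by simp_all
  moreover have "?z \<in> plane" using C by auto
  ultimately show ?thesis by blast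
qed

lemma add_eq_iff:
  assumes "a \<in> carrier R" "b \<in> carrier R" "c \<in> carrier R"
  shows "a \<oplus> b = c \<longleftrightarrow> b = c \<ominus> a"
proof
  assume c: "a \<oplus> b = c"
  have "b = (a \<oplus> b) \<ominus> a" using assms by algebra
  then show "b = c \<ominus> a" unfolding c .
next
  assume "b = c \<ominus> a" then show "a \<oplus> b = c" using assms by algebra
qed

lemma reflect_ex1:
  assumes l: "(n, b) \<in> lines" and y: "y \<in> plane"
  shows "\<exists>!z. z \<in> plane \<and> dot n y \<oplus> dot n z = b \<and> cross n y = cross n z"
proof -
  have n: "n \<in> normals" "b \<in> carrier R" using l unfolding lines_def by auto
  note N = normals_closed[OF n(1)]
  obtain z where z: "z \<in> plane" "dot n z = b \<ominus> dot n y" "cross n z = cross n y"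
    using dot_cross_solve[OF n(1), of "b \<ominus> dot n y" "cross n y"] n N y by auto
  show ?thesis
  proof (rule ex1I[of _ z])
    show "z \<in> plane \<and> dot n y \<oplus> dot n z = b \<and> cross n y = cross n z"
      using z n N y by (simp add: add_eq_iff)
  next
    fix w assume "w \<in> plane \<and> dot n y \<oplus> dot n w = b \<and> cross n y = cross n w"
    then have "w \<in> plane" "dot n y \<oplus> dot n w = b" "cross n y = cross n w" by auto
    then show "w = z"
      using dot_cross_inject[OF n(1), of w z] z n N y by (simp add: add_eq_iff)
  qed
qed

lemma reflect_iff:
  assumes l: "(n, b) \<in> lines" and y: "y \<in> plane" and z: "z \<in> plane"
  shows "reflect (n, b) y = z \<longleftrightarrow> dot n y \<oplus> dot n z = b \<and> cross n y = cross n z"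
  using theI'[OF reflect_ex1[OF l y]] reflect_ex1[OF l y] z
  unfolding reflect_def by auto

lemma reflect_closed: "l \<in> lines \<Longrightarrow> y \<in> plane \<Longrightarrow> reflect l y \<in> plane"
  using theI'[OF reflect_ex1[of "fst l" "snd l" y]] unfolding reflect_def by simp

lemma reflect_eqs:
  assumes "(n, b) \<in> lines" "y \<in> plane" "reflect (n, b) y = z"
  shows "dot n y \<oplus> dot n z = b" "cross n y = cross n z"
  using reflect_iff[OF assms(1,2), of z] reflect_closed[OF assms(1,2)] assms(3) by auto

lemma reflect_reflect: "l \<in> lines \<Longrightarrow> y \<in> plane \<Longrightarrow> reflect l (reflect l y) = y"
proof -
  assume l: "l \<in> lines" and y: "y \<in> plane"
  obtain n b where nb: "l = (n, b)" by (cases l)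
  have N: "n \<in> plane" using l nb normals_closed unfolding lines_def by auto
  show ?thesis
    using reflect_eqs[OF l[unfolded nb] y refl] reflect_closed[OF l y] N y l
    unfolding nb by (subst reflect_iff) (auto simp: a_comm)
qed

text \<open>The linear part of a reflection with normal \<open>n\<close>, written as a relation: the
  component along \<open>n\<close> changes sign and the other is kept. On difference vectors the
  offset of the axis drops out.\<close>

definition opposite :: "'a \<times> 'a \<Rightarrow> 'a \<times> 'a \<Rightarrow> 'a \<times> 'a \<Rightarrow> bool" where
  "opposite n d e \<longleftrightarrow> dot n d \<oplus> dot n e = \<zero> \<and> cross n d = cross n e"

lemma reflect_opposite:
  assumes l: "(n, b) \<in> lines" and y: "y \<in> plane" "y' \<in> plane"
  shows "opposite n (vdiff y y') (vdiff (reflect (n, b) y) (reflect (n, b) y'))"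
proof -
  have N: "n \<in> plane" using l normals_closed unfolding lines_def by auto
  note cl = reflect_closed[OF l y(1)] reflect_closed[OF l y(2)]
  have swap: "(a \<ominus> b) \<oplus> (c \<ominus> d) = (a \<oplus> c) \<ominus> (b \<oplus> d)"
    if "a \<in> carrier R" "b \<in> carrier R" "c \<in> carrier R" "d \<in> carrier R" for a b c d
    using that by algebra
  show ?thesis
    using reflect_eqs[OF l y(1) refl] reflect_eqs[OF l y(2) refl] N y cl l
    unfolding opposite_def lines_def by (simp add: dot_vdiff cross_vdiff swap r_right_minus_eq)
qed

lemma opposite_unique:
  assumes n: "n \<in> normals" and de: "d \<in> plane" "d' \<in> plane" "e \<in> plane"
    and "opposite n d e" "opposite n d' e"
  shows "d = d'"
proof -
  note N = normals_closed[OF n]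
  have "dot n d = dot n d'"
    using assms N unfolding opposite_def by (metis add.r_cancel dot_closed)
  then show ?thesis using dot_cross_inject[OF n de(1,2)] assms unfolding opposite_def by auto
qed

lemma opposite_sym:
  assumes "n \<in> plane" "d \<in> plane" "e \<in> plane" "opposite n d e" shows "opposite n e d"
  using assms unfolding opposite_def by (auto simp: a_comm)

text \<open>If \<open>d = e\<close>, then twice \<open>dot n e\<close> vanishes, so \<open>n\<close>
  is perpendicular to \<open>e\<close>; otherwise \<open>n\<close> is parallel to
  \<open>d - e\<close>. Either condition leaves one direction.\<close>

lemma opposite_normal_unique:
  assumes n: "n \<in> normals" "n' \<in> normals" and de: "d \<in> plane" "e \<in> plane" "e \<noteq> (\<zero>, \<zero>)"
    and o: "opposite n d e" "opposite n' d e"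
  shows "n = n'"
proof (cases "d = e")
  case True
  have "dot n e = \<zero>" "dot n' e = \<zero>"
    using o n de normals_closed unfolding opposite_def True
    by (metis add_self_eq_zero dot_closed)+
  then show ?thesis using normal_unique[OF n de(2,3)] by simp
next
  case False
  then have "vdiff d e \<noteq> (\<zero>, \<zero>)" using vdiff_eq_zero_iff de by blast
  moreover have "cross n (vdiff d e) = \<zero>" "cross n' (vdiff d e) = \<zero>"
    using o normals_closed n de unfolding opposite_def by (simp_all add: cross_vdiff r_right_minus_eq)
  ultimately show ?thesis using normal_unique_cross[OF n vdiff_closed[OF de(1,2)]] by simp
qed

text \<open>\<open>d - e\<close> is parallel to \<open>n\<close> and \<open>d + e\<close> is
  perpendicular to it, so their inner product, the difference of the norms, vanishes.\<close>

lemma opposite_norm: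
  assumes n: "n \<in> normals" and de: "d \<in> plane" "e \<in> plane" and o: "opposite n d e"
  shows "dot d d = dot e e"
proof -
  note N = normals_closed[OF n]
  have "dot (vdiff d e) (vsum d e) = \<zero>"
  proof (rule parallel_perpendicular[OF N normal_nonzero[OF n]])
    show "cross n (vdiff d e) = \<zero>" "dot n (vsum d e) = \<zero>"
      using o N de unfolding opposite_def by (simp_all add: cross_vdiff dot_vsum r_right_minus_eq)
  qed (use de in simp_all)
  then show ?thesis using dot_self_diff[OF de] de by (simp add: r_right_minus_eq)
qed

section \<open>Verification of the reflection axioms for the affine plane\<close>

lemma linesE:
  assumes "l \<in> lines" obtains n b where "l = (n, b)" "n \<in> normals" "b \<in> carrier R" "n \<in> plane"
  using assms normals_closed unfolding lines_def by auto

lemma reflect_isometry: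
  assumes l: "l \<in> lines" and y: "y \<in> plane" "z \<in> plane"
  shows "sqdist R (reflect l y) (reflect l z) = sqdist R y z"
proof -
  obtain n b where nb: "l = (n, b)" "n \<in> normals" using linesE[OF l] by metis
  show ?thesis
    using opposite_norm[OF nb(2) _ _ reflect_opposite[OF l[unfolded nb] y]] reflect_closed[OF l] y
    by (simp add: sqdist_eq_dot nb)
qed

text \<open>The normal has to be parallel to \<open>y - z\<close>, and then the offset is forced to
  be \<open>dot n y \<oplus> dot n z\<close>.\<close>

lemma ex1_bisector:
  assumes y: "y \<in> plane" "z \<in> plane" "y \<noteq> z"
  shows "\<exists>!l. l \<in> lines \<and> reflect l y = z"
proof -
  have nz: "vdiff y z \<in> plane" "vdiff y z \<noteq> (\<zero>, \<zero>)" using vdiff_eq_zero_iff y by auto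
  obtain n where n: "n \<in> normals" "cross n (vdiff y z) = \<zero>" using normal_exists_cross[OF nz(1)] by blast
  note N = normals_closed[OF n(1)]
  let ?l = "(n, dot n y \<oplus> dot n z)"
  have l: "?l \<in> lines" unfolding lines_def using n(1) N y by simp
  have par: "cross m y = cross m z \<longleftrightarrow> cross m (vdiff y z) = \<zero>" if "m \<in> plane" for m
    using that y by (simp add: cross_vdiff r_right_minus_eq)
  show ?thesis
  proof (rule ex1I[of _ ?l])
    show "?l \<in> lines \<and> reflect ?l y = z"
      using l reflect_iff[OF l y(1,2)] par[OF N] n(2) by simp
  next
    fix l' assume l': "l' \<in> lines \<and> reflect l' y = z"
    then obtain n' b' where nb: "l' = (n', b')" "n' \<in> normals" "n' \<in> plane" using linesE by metis
    have *: "dot n' y \<oplus> dot n' z = b'" "cross n' y = cross n' z"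
      using reflect_eqs[of n' b' y z] l' y nb(1) by auto
    have "n' = n" using normal_unique_cross[OF nb(2) n(1) nz] *(2) par[OF nb(3)] n(2) by simp
    with * nb(1) show "l' = ?l" by simp
  qed
qed

lemma reflect_fixed_iff:
  assumes "(n, b) \<in> lines" "y \<in> plane"
  shows "reflect (n, b) y = y \<longleftrightarrow> dot n y \<oplus> dot n y = b"
  using reflect_iff[OF assms(1,2,2)] by simp

text \<open>With \<open>u = x - y\<close> and \<open>v = x - z\<close>, equal norms give that
  \<open>u - v\<close> is perpendicular to \<open>u + v\<close>. As \<open>u - v = z - y\<close> is
  nonzero and parallel to \<open>n\<close>, also \<open>n\<close> is perpendicular to
  \<open>u + v\<close>, which is the equation of the axis at \<open>x\<close>.\<close>

lemma equidistant_fixed: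
  assumes l: "l \<in> lines" and x: "x \<in> plane" "y \<in> plane" and ne: "reflect l y \<noteq> y"
    and eq: "sqdist R x y = sqdist R x (reflect l y)"
  shows "reflect l x = x"
proof -
  obtain n b where nb: "l = (n, b)" "n \<in> normals" "b \<in> carrier R" "n \<in> plane" using linesE[OF l] by metis
  define z where "z = reflect l y"
  have z: "z \<in> plane" unfolding z_def using reflect_closed l x by simp
  have e: "dot n y \<oplus> dot n z = b" "cross n y = cross n z"
    using reflect_eqs[of n b y z] l nb(1) x z_def by auto
  let ?u = "vdiff x y" and ?v = "vdiff x z"
  have uv: "?u \<in> plane" "?v \<in> plane" using x z by simp_all
  have "dot (vdiff ?u ?v) (vsum ?u ?v) = \<zero>"
    using dot_self_diff[OF uv, symmetric] eq x z uv unfolding z_def[symmetric]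
    by (simp add: sqdist_eq_dot r_right_minus_eq)
  moreover have "vdiff ?u ?v \<noteq> (\<zero>, \<zero>)"
  proof
    assume "vdiff ?u ?v = (\<zero>, \<zero>)"
    then have "?u = ?v" using vdiff_eq_zero_iff uv by blast
    then have "y = z" using vdiff_left_cancel x z by blast
    then show False using ne z_def by simp
  qed
  moreover have "cross (vdiff ?u ?v) n = \<zero>"
  proof (rule cross_commute_zero)
    show "cross n (vdiff ?u ?v) = \<zero>"
      using e(2) uv x z nb(4) by (simp add: cross_vdiff r_right_minus_eq)
  qed (use uv nb(4) in simp_all)
  ultimately have "dot n (vsum ?u ?v) = \<zero>"
    using uv nb(4) parallel_perpendicular[of "vdiff ?u ?v" n "vsum ?u ?v"] by simp
  moreover have swap: "(p \<ominus> q) \<oplus> (p \<ominus> r) = (p \<oplus> p) \<ominus> (q \<oplus> r)"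
    if "p \<in> carrier R" "q \<in> carrier R" "r \<in> carrier R" for p q r
    using that by algebra
  ultimately have "dot n x \<oplus> dot n x = b"
    using uv nb x z e(1) by (simp add: dot_vsum dot_vdiff r_right_minus_eq)
  then show ?thesis using reflect_fixed_iff l nb(1) x by blast
qed

lemma card_lines_through:
  assumes y: "y \<in> plane"
  shows "card {l \<in> lines. reflect l y = y} = order R + 1"
proof -
  have "{l \<in> lines. reflect l y = y} = (\<lambda>n. (n, dot n y \<oplus> dot n y)) ` normals"
    using reflect_fixed_iff[OF _ y] normals_closed y
    by (auto simp: lines_def image_iff)
  then show ?thesis using card_normals by (simp add: card_image inj_on_def)
qed

lemma ex1_line:
  assumes y: "y \<in> plane" "z \<in> plane" "y \<noteq> z"
  shows "\<exists>!l. l \<in> lines \<and> reflect l y = y \<and> reflect l z = z"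
proof -
  have nz: "vdiff y z \<in> plane" "vdiff y z \<noteq> (\<zero>, \<zero>)" using vdiff_eq_zero_iff y by auto
  obtain n where n: "n \<in> normals" "dot n (vdiff y z) = \<zero>" using normal_exists[OF nz(1)] by blast
  note N = normals_closed[OF n(1)]
  let ?l = "(n, dot n y \<oplus> dot n y)"
  have l: "?l \<in> lines" unfolding lines_def using n(1) N y by simp
  \<comment> \<open>Both points are on an axis with normal \<open>m\<close> exactly if
    \<open>m\<close> is perpendicular to \<open>y - z\<close>; odd characteristic allows the
    doubling to be cancelled.\<close>
  have perp: "dot m y \<oplus> dot m y = dot m z \<oplus> dot m z \<longleftrightarrow> dot m (vdiff y z) = \<zero>" if "m \<in> plane" for m
  proof
    have "(dot m y \<ominus> dot m z) \<oplus> (dot m y \<ominus> dot m z) = (dot m y \<oplus> dot m y) \<ominus> (dot m z \<oplus> dot m z)"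
      using dot_closed[OF that y(1)] dot_closed[OF that y(2)] by algebra
    moreover assume "dot m y \<oplus> dot m y = dot m z \<oplus> dot m z"
    ultimately have "(dot m y \<ominus> dot m z) \<oplus> (dot m y \<ominus> dot m z) = \<zero>"
      using that y by (simp add: r_right_minus_eq)
    then show "dot m (vdiff y z) = \<zero>"
      using that y add_self_eq_zero[of "dot m y \<ominus> dot m z"] by (simp add: dot_vdiff)
  next
    assume "dot m (vdiff y z) = \<zero>"
    then show "dot m y \<oplus> dot m y = dot m z \<oplus> dot m z"
      using that y by (simp add: dot_vdiff r_right_minus_eq)
  qed
  show ?thesis
  proof (rule ex1I[of _ ?l])
    show "?l \<in> lines \<and> reflect ?l y = y \<and> reflect ?l z = z"
      using l reflect_fixed_iff[OF l] y perp[OF N] n(2) by simp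
  next
    fix l' assume l': "l' \<in> lines \<and> reflect l' y = y \<and> reflect l' z = z"
    then obtain n' b' where nb: "l' = (n', b')" "n' \<in> normals" "n' \<in> plane" using linesE by metis
    have *: "dot n' y \<oplus> dot n' y = b'" "dot n' z \<oplus> dot n' z = b'"
      using reflect_fixed_iff[of n' b'] l' y nb(1) by auto
    have "n' = n" using normal_unique[OF nb(2) n(1) nz] * perp[OF nb(3)] n(2) by simp
    with * nb(1) show "l' = ?l" by simp
  qed
qed

lemma card_common_images:
  assumes a: "a \<in> plane" "a' \<in> plane" and c: "c \<in> plane" "c' \<in> plane"
    and ne: "a \<noteq> a'" "(a, a') \<noteq> (c, c')"
  shows "card {(l, l') \<in> lines \<times> lines. reflect l a = reflect l' c \<and> reflect l a' = reflect l' c'} \<le> order R + 1"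
proof -
  define S where "S = {(l, l') \<in> lines \<times> lines. reflect l a = reflect l' c \<and> reflect l a' = reflect l' c'}"
  let ?d = "vdiff a a'" and ?d' = "vdiff c c'"
  have dcl: "?d \<in> plane" "?d' \<in> plane" using a c by simp_all
  \<comment> \<open>Here \<open>u\<close> is the common image of \<open>a\<close> and
    \<open>c\<close>, and \<open>e\<close> is the common difference vector of the two image pairs.
    The normals together with \<open>u\<close> determine both lines.\<close>
  have mem: "\<exists>n b n' b' u e. l = (n, b) \<and> l' = (n', b') \<and> n \<in> normals \<and> n' \<in> normals \<and> n \<in> plane \<and> n' \<in> plane
      \<and> u \<in> plane \<and> e \<in> plane \<and> e \<noteq> (\<zero>, \<zero>)
      \<and> opposite n ?d e \<and> opposite n' ?d' e \<and> cross n a = cross n u \<and> cross n' c = cross n' u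
      \<and> b = dot n a \<oplus> dot n u \<and> b' = dot n' c \<oplus> dot n' u \<and> u = reflect l a"
    if S: "(l, l') \<in> S" for l l'
  proof -
    have l: "l \<in> lines" "l' \<in> lines" "reflect l a = reflect l' c" "reflect l a' = reflect l' c'"
      using S unfolding S_def by auto
    obtain n b where nb: "l = (n, b)" "n \<in> normals" "b \<in> carrier R" "n \<in> plane" using linesE[OF l(1)] by metis
    obtain n' b' where nb': "l' = (n', b')" "n' \<in> normals" "b' \<in> carrier R" "n' \<in> plane" using linesE[OF l(2)] by metis
    let ?u = "reflect l a" and ?u' = "reflect l a'"
    have u: "?u \<in> plane" "?u' \<in> plane" using reflect_closed[OF l(1)] a by blast+
    have "?u \<noteq> ?u'" using reflect_reflect[OF l(1) a(1)] reflect_reflect[OF l(1) a(2)] ne(1) by metis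
    then have "vdiff ?u ?u' \<noteq> (\<zero>, \<zero>)" using vdiff_eq_zero_iff u by blast
    moreover have "opposite n ?d (vdiff ?u ?u')"
      using reflect_opposite[of n b, OF _ a] l nb by simp
    moreover have "opposite n' ?d' (vdiff ?u ?u')"
      using reflect_opposite[of n' b', OF _ c] l nb' by simp
    moreover have "dot n a \<oplus> dot n ?u = b" "cross n a = cross n ?u"
      using reflect_eqs[of n b a ?u] l nb a by simp_all
    moreover have "dot n' c \<oplus> dot n' ?u = b'" "cross n' c = cross n' ?u"
      using reflect_eqs[of n' b' c ?u] l nb' c by simp_all
    ultimately show ?thesis
      using nb nb' u vdiff_closed[OF u] by metis
  qed
  have fin: "finite normals" unfolding normals_def using finite_carrier by simp
  \<comment> \<open>If the difference vectors differ, the two reflections have different axis directions and the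
    first direction determines both lines; if they agree, both axes are orthogonal to \<open>a - c\<close> and the
    offset of the first line determines the second.\<close>
  show ?thesis
  proof (cases "?d = ?d'")
    case False
    have "inj_on (\<lambda>p. fst (fst p)) S"
    proof (rule inj_onI)
      fix p p2 assume S: "p \<in> S" "p2 \<in> S" and same: "fst (fst p) = fst (fst p2)"
      obtain l l' l2 l2' where p: "p = (l, l')" "p2 = (l2, l2')" by (metis surj_pair)
      obtain n b n' b' u e where
        1: "l = (n, b)" "l' = (n', b')" "n \<in> normals" "n' \<in> normals" "n \<in> plane" "n' \<in> plane"
           "u \<in> plane" "e \<in> plane" "e \<noteq> (\<zero>, \<zero>)"
           "opposite n ?d e" "opposite n' ?d' e" "cross n a = cross n u" "cross n' c = cross n' u"
           "b = dot n a \<oplus> dot n u" "b' = dot n' c \<oplus> dot n' u"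
        using mem[OF S(1)[unfolded p(1)]] by blast
      obtain m f m' f' v g where
        2: "l2 = (m, f)" "l2' = (m', f')" "m' \<in> normals" "m' \<in> plane"
           "v \<in> plane" "g \<in> plane" "g \<noteq> (\<zero>, \<zero>)"
           "opposite m ?d g" "opposite m' ?d' g" "cross m a = cross m v" "cross m' c = cross m' v"
           "f = dot m a \<oplus> dot m v" "f' = dot m' c \<oplus> dot m' v"
        using mem[OF S(2)[unfolded p(2)]] by blast
      have m: "m = n" using same p 1 2 by simp
      have eg: "g = e"
        using opposite_unique[OF 1(3) 2(6) 1(8) dcl(1)] opposite_sym 1 2 dcl m by blast
      have m': "m' = n'"
        using opposite_normal_unique[OF 2(3) 1(4) dcl(2) 1(8,9)] 1 2 eg by blast
      \<comment> \<open>A single linear reflection cannot send two different vectors to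
        \<open>e\<close>.\<close>
      have nn': "n \<noteq> n'"
        using opposite_unique[OF 1(3) dcl 1(8)] 1(10,11) False by blast
      \<comment> \<open>\<open>u\<close> and \<open>v\<close> both lie on the line through
        \<open>a\<close> in direction \<open>n\<close> and on the line through \<open>c\<close> in
        direction \<open>n'\<close>; these are not parallel.\<close>
      have "u = v"
      proof (rule ccontr)
        assume "u \<noteq> v"
        then have z: "vdiff u v \<in> plane" "vdiff u v \<noteq> (\<zero>, \<zero>)" using vdiff_eq_zero_iff 1 2 by auto
        have "cross n (vdiff u v) = \<zero>" "cross n' (vdiff u v) = \<zero>"
          using 1 2 m m' by (simp_all add: cross_vdiff r_right_minus_eq)
        then show False using normal_unique_cross[OF 1(3,4) z] nn' by simp
      qed
      then show "p = p2" using p 1 2 m m' by simp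
    qed
    moreover have "(\<lambda>p. fst (fst p)) ` S \<subseteq> normals" unfolding S_def lines_def by auto
    ultimately have "card S \<le> card normals" using fin by (rule card_inj_on_le)
    then show ?thesis unfolding S_def card_normals .
  next
    case True
    have ac: "a \<noteq> c"
    proof
      assume "a = c"
      then have "a' = c'" using vdiff_left_cancel[OF a c(2)] True by simp
      then show False using \<open>a = c\<close> ne(2) by simp
    qed
    then have z: "vdiff a c \<in> plane" "vdiff a c \<noteq> (\<zero>, \<zero>)" using vdiff_eq_zero_iff a c by auto
    \<comment> \<open>Equal difference vectors with the same image \<open>e\<close> force equal
      normals; then \<open>a\<close> and \<open>c\<close> are both displaced from \<open>u\<close>
      along that normal.\<close>
    have par: "fst l = fst l' \<and> cross (fst l) (vdiff a c) = \<zero>" if S: "(l, l') \<in> S" for l l'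
    proof -
      obtain n b n' b' u e where
        1: "l = (n, b)" "l' = (n', b')" "n \<in> normals" "n' \<in> normals" "n \<in> plane"
           "u \<in> plane" "e \<in> plane" "e \<noteq> (\<zero>, \<zero>)"
           "opposite n ?d e" "opposite n' ?d' e" "cross n a = cross n u" "cross n' c = cross n' u"
        using mem[OF S] by blast
      have "n = n'" using opposite_normal_unique[OF 1(3,4) dcl(1) 1(7,8)] 1(9,10) True by simp
      then show ?thesis using 1 a c by (simp add: cross_vdiff r_right_minus_eq)
    qed
    have "inj_on (\<lambda>p. snd (fst p)) S"
    proof (rule inj_onI)
      fix p p2 assume S: "p \<in> S" "p2 \<in> S" and same: "snd (fst p) = snd (fst p2)"
      obtain l l' l2 l2' where p: "p = (l, l')" "p2 = (l2, l2')" by (metis surj_pair)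
      have li: "l \<in> lines" "l2 \<in> lines" using S p unfolding S_def by auto
      have "fst l = fst l2"
        using normal_unique_cross[of "fst l" "fst l2", OF _ _ z]
          par[OF S(1)[unfolded p(1)]] par[OF S(2)[unfolded p(2)]] li
        unfolding lines_def mem_Times_iff by blast
      then have eq: "l = l2" using same p by (simp add: prod_eq_iff)
      have "fst l' = fst l2'"
        using par[OF S(1)[unfolded p(1)]] par[OF S(2)[unfolded p(2)]] eq by simp
      moreover have "snd l' = dot (fst l') c \<oplus> dot (fst l') (reflect l a)"
        using mem[OF S(1)[unfolded p(1)]] by auto
      moreover have "snd l2' = dot (fst l2') c \<oplus> dot (fst l2') (reflect l2 a)"
        using mem[OF S(2)[unfolded p(2)]] by auto
      ultimately have "l' = l2'" using eq by (metis prod_eqI)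
      with eq p show "p = p2" by simp
    qed
    moreover have "(\<lambda>p. snd (fst p)) ` S \<subseteq> carrier R" unfolding S_def lines_def by auto
    ultimately have "card S \<le> card (carrier R)" using finite_carrier by (rule card_inj_on_le)
    then show ?thesis unfolding S_def order_def by simp
  qed
qed

subsection \<open>Representation counts of sums of distances\<close>

lemma order_pos: "real (order R) > 0"
  using order_mod_4 by (cases "order R = 0") auto

section \<open>Sums over the field and cancellation over the plane\<close>

lemma sum_affine:
  fixes f :: "'a \<Rightarrow> real"
  assumes c: "c \<in> carrier R" "c \<noteq> \<zero>" and d: "d \<in> carrier R"
  shows "(\<Sum>x\<in>carrier R. f (c \<otimes> x \<oplus> d)) = (\<Sum>x\<in>carrier R. f x)"
proof (rule sum.reindex_bij_betw)
  have "inj_on (\<lambda>x. c \<otimes> x \<oplus> d) (carrier R)"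
    using c d by (intro inj_onI) (simp add: m_lcancel)
  moreover have "(\<lambda>x. c \<otimes> x \<oplus> d) ` carrier R \<subseteq> carrier R" using c d by auto
  ultimately show "bij_betw (\<lambda>x. c \<otimes> x \<oplus> d) (carrier R) (carrier R)"
    using endo_inj_surj[OF finite_carrier] unfolding bij_betw_def by blast
qed

lemma sum_translate:
  fixes f :: "'a \<Rightarrow> real"
  assumes d: "d \<in> carrier R"
  shows "(\<Sum>x\<in>carrier R. f (x \<oplus> d)) = (\<Sum>x\<in>carrier R. f x)"
  using sum_affine[of \<one> d f] d by simp

lemma sum_translate_minus:
  fixes f :: "'a \<Rightarrow> real"
  assumes d: "d \<in> carrier R"
  shows "(\<Sum>x\<in>carrier R. f (x \<ominus> d)) = (\<Sum>x\<in>carrier R. f x)"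
  using sum_translate[of "\<ominus> d" f] d by (simp add: minus_eq)

text \<open>The squares of the coordinates of \<open>x\<close> cancel. What remains is affine in
  \<open>x\<close>, with linear coefficients twice those of \<open>z - y\<close>.\<close>

lemma sqdist_diff:
  assumes "x1 \<in> carrier R" "x2 \<in> carrier R" and y: "y \<in> plane" and z: "z \<in> plane" and t: "t \<in> carrier R"
  shows "t \<oplus> (sqdist R (x1, x2) y \<ominus> sqdist R (x1, x2) z) =
    ((fst z \<ominus> fst y) \<oplus> (fst z \<ominus> fst y)) \<otimes> x1 \<oplus>
    (((snd z \<ominus> snd y) \<oplus> (snd z \<ominus> snd y)) \<otimes> x2 \<oplus>
      (t \<oplus> ((fst y \<otimes> fst y \<ominus> fst z \<otimes> fst z) \<oplus> (snd y \<otimes> snd y \<ominus> snd z \<otimes> snd z))))"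
proof -
  have sq: "(x \<ominus> a) \<otimes> (x \<ominus> a) \<ominus> (x \<ominus> b) \<otimes> (x \<ominus> b) = ((b \<ominus> a) \<oplus> (b \<ominus> a)) \<otimes> x \<oplus> (a \<otimes> a \<ominus> b \<otimes> b)"
    if "x \<in> carrier R" "a \<in> carrier R" "b \<in> carrier R" for x a b
    using that by algebra
  have swap: "(a \<oplus> b) \<ominus> (c \<oplus> d) = (a \<ominus> c) \<oplus> (b \<ominus> d)"
    if "a \<in> carrier R" "b \<in> carrier R" "c \<in> carrier R" "d \<in> carrier R" for a b c d
    using that by algebra
  have arrange: "e \<oplus> ((a \<oplus> b) \<oplus> (c \<oplus> d)) = a \<oplus> (c \<oplus> (e \<oplus> (b \<oplus> d)))"
    if "a \<in> carrier R" "b \<in> carrier R" "c \<in> carrier R" "d \<in> carrier R" "e \<in> carrier R" for a b c d e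
    using that by algebra
  show ?thesis
    using assms unfolding sqdist_def by (simp add: numeral_2_eq_2 swap sq arrange)
qed

text \<open>Some linear coefficient is nonzero. Summing first over that coordinate runs through the
  whole field, where \<open>f\<close> has sum zero.\<close>

lemma sum_sqdist_diff:
  fixes f :: "'a \<Rightarrow> real"
  assumes y: "y \<in> plane" "z \<in> plane" "y \<noteq> z" and t: "t \<in> carrier R"
    and f: "(\<Sum>s\<in>carrier R. f s) = 0"
  shows "(\<Sum>x\<in>plane. f (t \<oplus> (sqdist R x y \<ominus> sqdist R x z))) = 0"
proof -
  let ?c1 = "(fst z \<ominus> fst y) \<oplus> (fst z \<ominus> fst y)" and ?c2 = "(snd z \<ominus> snd y) \<oplus> (snd z \<ominus> snd y)"
  let ?k = "t \<oplus> ((fst y \<otimes> fst y \<ominus> fst z \<otimes> fst z) \<oplus> (snd y \<otimes> snd y \<ominus> snd z \<otimes> snd z))"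
  have cl: "?c1 \<in> carrier R" "?c2 \<in> carrier R" "?k \<in> carrier R" using y t by simp_all
  have eq: "(\<Sum>x\<in>plane. f (t \<oplus> (sqdist R x y \<ominus> sqdist R x z))) =
      (\<Sum>x1\<in>carrier R. \<Sum>x2\<in>carrier R. f (?c1 \<otimes> x1 \<oplus> (?c2 \<otimes> x2 \<oplus> ?k)))"
    unfolding plane_def sum.cartesian_product
    by (intro sum.cong refl) (auto simp: sqdist_diff[OF _ _ y(1,2) t])
  have nz: "?c1 \<noteq> \<zero> \<or> ?c2 \<noteq> \<zero>"
  proof (rule ccontr)
    assume "\<not> ?thesis"
    then have "fst z \<ominus> fst y = \<zero>" "snd z \<ominus> snd y = \<zero>"
      using add_self_eq_zero y by (metis minus_closed plane_components)+
    then show False using y by (simp add: r_right_minus_eq prod_eq_iff)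
  qed
  show ?thesis
  proof (cases "?c1 = \<zero>")
    case True
    then have c2: "?c2 \<noteq> \<zero>" using nz by simp
    have "(\<Sum>x2\<in>carrier R. f (?c1 \<otimes> x1 \<oplus> (?c2 \<otimes> x2 \<oplus> ?k))) = 0" if "x1 \<in> carrier R" for x1
    proof -
      have "(\<Sum>x2\<in>carrier R. f (?c1 \<otimes> x1 \<oplus> (?c2 \<otimes> x2 \<oplus> ?k))) =
          (\<Sum>x2\<in>carrier R. f (?c2 \<otimes> x2 \<oplus> ?k))"
        using cl that unfolding True by (intro sum.cong refl) simp
      then show ?thesis using sum_affine[OF cl(2) c2 cl(3), of f] f by simp
    qed
    then show ?thesis unfolding eq by simp
  next
    case False
    have "(\<Sum>x1\<in>carrier R. f (?c1 \<otimes> x1 \<oplus> (?c2 \<otimes> x2 \<oplus> ?k))) = 0" if "x2 \<in> carrier R" for x2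
      using sum_affine[OF cl(1) False, of "?c2 \<otimes> x2 \<oplus> ?k" f] cl that f by simp
    then show ?thesis unfolding eq by (subst sum.swap) simp
  qed
qed

text \<open>The share of one point \<open>x\<close> in the convolution of \<open>f\<close> with the
  distance counts of \<open>E\<close>. Keeping \<open>x\<close> separate lets later estimates extend
  it from \<open>E\<close> to the whole plane.\<close>

definition point_conv :: "('a \<times> 'a) set \<Rightarrow> ('a \<Rightarrow> real) \<Rightarrow> 'a \<times> 'a \<Rightarrow> 'a \<Rightarrow> real" where
  "point_conv E f x t = (\<Sum>y\<in>E. f (t \<ominus> sqdist R x y))"

definition conv :: "('a \<times> 'a) set \<Rightarrow> ('a \<Rightarrow> real) \<Rightarrow> 'a \<Rightarrow> real" where
  "conv E f t = (\<Sum>x\<in>E. point_conv E f x t)"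

lemma finite_plane: "finite plane" unfolding plane_def using finite_carrier by simp

lemma card_plane: "card plane = (order R)\<^sup>2"
  unfolding plane_def order_def by (simp add: card_cartesian_product power2_eq_square)

text \<open>Shifting \<open>t\<close> by the distance from \<open>x\<close> to \<open>y\<close>
  frees one factor of \<open>x\<close>. For \<open>y \<noteq> z\<close> the other factor then sums
  to zero over the plane.\<close>

lemma sum_correlation:
  fixes f :: "'a \<Rightarrow> real"
  assumes y: "y \<in> plane" "z \<in> plane" and f: "(\<Sum>s\<in>carrier R. f s) = 0"
  shows "(\<Sum>x\<in>plane. \<Sum>t\<in>carrier R. f (t \<ominus> sqdist R x y) * f (t \<ominus> sqdist R x z)) =
    of_bool (y = z) * ((real (order R))\<^sup>2 * (\<Sum>t\<in>carrier R. (f t)\<^sup>2))"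
proof -
  have "(\<Sum>t\<in>carrier R. f (t \<ominus> sqdist R x y) * f (t \<ominus> sqdist R x z)) =
      (\<Sum>t\<in>carrier R. f t * f (t \<oplus> (sqdist R x y \<ominus> sqdist R x z)))" if x: "x \<in> plane" for x
  proof -
    have c: "sqdist R x y \<in> carrier R" "sqdist R x z \<in> carrier R" using sqdist_closed x y by auto
    have *: "(t \<oplus> p) \<ominus> p = t" "(t \<oplus> p) \<ominus> r = t \<oplus> (p \<ominus> r)"
      if "t \<in> carrier R" "p \<in> carrier R" "r \<in> carrier R" for t p r
      using that by algebra+
    have "(\<Sum>t\<in>carrier R. f (t \<ominus> sqdist R x y) * f (t \<ominus> sqdist R x z)) =
      (\<Sum>t\<in>carrier R. f ((t \<oplus> sqdist R x y) \<ominus> sqdist R x y) * f ((t \<oplus> sqdist R x y) \<ominus> sqdist R x z))"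
      by (rule sum_translate[OF c(1), symmetric])
    then show ?thesis using c by (simp add: * cong: sum.cong)
  qed
  then have "(\<Sum>x\<in>plane. \<Sum>t\<in>carrier R. f (t \<ominus> sqdist R x y) * f (t \<ominus> sqdist R x z)) =
      (\<Sum>x\<in>plane. \<Sum>t\<in>carrier R. f t * f (t \<oplus> (sqdist R x y \<ominus> sqdist R x z)))"
    by (rule sum.cong[OF refl])
  also have "\<dots> = (\<Sum>t\<in>carrier R. f t * (\<Sum>x\<in>plane. f (t \<oplus> (sqdist R x y \<ominus> sqdist R x z))))"
    unfolding sum_distrib_left by (rule sum.swap)
  also have "\<dots> = of_bool (y = z) * ((real (order R))\<^sup>2 * (\<Sum>t\<in>carrier R. (f t)\<^sup>2))"
  proof (cases "y = z")
    case True
    have "(\<Sum>x\<in>plane. f (t \<oplus> (sqdist R x z \<ominus> sqdist R x z))) = (real (order R))\<^sup>2 * f t"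
      if t: "t \<in> carrier R" for t
    proof -
      have "(\<Sum>x\<in>plane. f (t \<oplus> (sqdist R x z \<ominus> sqdist R x z))) = (\<Sum>x\<in>plane. f t)"
        using t y by (intro sum.cong refl) (simp add: minus_eq r_neg sqdist_closed)
      then show ?thesis using card_plane by simp
    qed
    then show ?thesis using True by (simp add: sum_distrib_left power2_eq_square mult_ac cong: sum.cong)
  next
    case False
    then show ?thesis using sum_sqdist_diff[OF y False _ f] by simp
  qed
  finally show ?thesis .
qed

lemma sum_add_const_sq:
  fixes f :: "'i \<Rightarrow> real"
  shows "(\<Sum>t\<in>A. (f t + c)\<^sup>2) = (\<Sum>t\<in>A. (f t)\<^sup>2) + real (card A) * c\<^sup>2 + 2 * c * (\<Sum>t\<in>A. f t)"
proof -
  have "(\<Sum>t\<in>A. 2 * f t * c) = 2 * c * (\<Sum>t\<in>A. f t)"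
    unfolding sum_distrib_left by (simp add: mult_ac)
  then show ?thesis by (simp add: power2_sum sum.distrib)
qed

lemma sum_square_expand:
  fixes g :: "'i \<Rightarrow> 'j \<Rightarrow> 'k \<Rightarrow> real"
  shows "(\<Sum>x\<in>A. \<Sum>t\<in>B. (\<Sum>y\<in>C. g x t y)\<^sup>2) = (\<Sum>y\<in>C. \<Sum>z\<in>C. \<Sum>x\<in>A. \<Sum>t\<in>B. g x t y * g x t z)"
proof -
  have pairs: "(\<Sum>x\<in>A. \<Sum>t\<in>B. h x t) = (\<Sum>p\<in>A\<times>B. h (fst p) (snd p))" for h :: "'i \<Rightarrow> 'j \<Rightarrow> real"
    by (simp add: sum.cartesian_product case_prod_beta)
  have "(\<Sum>x\<in>A. \<Sum>t\<in>B. (\<Sum>y\<in>C. g x t y)\<^sup>2) =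
      (\<Sum>p\<in>A\<times>B. \<Sum>y\<in>C. \<Sum>z\<in>C. g (fst p) (snd p) y * g (fst p) (snd p) z)"
    unfolding pairs by (simp add: power2_eq_square sum_product)
  also have "\<dots> = (\<Sum>y\<in>C. \<Sum>p\<in>A\<times>B. \<Sum>z\<in>C. g (fst p) (snd p) y * g (fst p) (snd p) z)"
    by (rule sum.swap)
  also have "\<dots> = (\<Sum>y\<in>C. \<Sum>z\<in>C. \<Sum>p\<in>A\<times>B. g (fst p) (snd p) y * g (fst p) (snd p) z)"
    by (intro sum.cong refl sum.swap)
  also have "\<dots> = (\<Sum>y\<in>C. \<Sum>z\<in>C. \<Sum>x\<in>A. \<Sum>t\<in>B. g x t y * g x t z)"
    by (intro sum.cong refl pairs[symmetric])
  finally show ?thesis .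
qed

context
  fixes E assumes E: "E \<subseteq> plane"
begin

lemma finite_points: "finite E" using E finite_plane by (rule finite_subset)

lemma sqdist_closed_points: "x \<in> E \<Longrightarrow> y \<in> E \<Longrightarrow> sqdist R x y \<in> carrier R"
  using sqdist_closed E by blast

lemma point_conv_norm:
  assumes f: "(\<Sum>s\<in>carrier R. f s) = 0"
  shows "(\<Sum>x\<in>plane. \<Sum>t\<in>carrier R. (point_conv E f x t)\<^sup>2) =
    real (card E) * (real (order R))\<^sup>2 * (\<Sum>t\<in>carrier R. (f t)\<^sup>2)"
proof -
  let ?S = "(real (order R))\<^sup>2 * (\<Sum>t\<in>carrier R. (f t)\<^sup>2)"
  have "(\<Sum>x\<in>plane. \<Sum>t\<in>carrier R. (point_conv E f x t)\<^sup>2) =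
      (\<Sum>y\<in>E. \<Sum>z\<in>E. \<Sum>x\<in>plane. \<Sum>t\<in>carrier R. f (t \<ominus> sqdist R x y) * f (t \<ominus> sqdist R x z))"
    unfolding point_conv_def by (rule sum_square_expand)
  also have "\<dots> = (\<Sum>y\<in>E. \<Sum>z\<in>E. of_bool (y = z) * ?S)"
    using E by (intro sum.cong refl sum_correlation f) auto
  also have "\<dots> = (\<Sum>y\<in>E. ?S)"
    by (intro sum.cong refl) (use finite_points in \<open>simp add: of_bool_def if_distrib[of "\<lambda>u. u * _"] cong: if_cong\<close>)
  finally show ?thesis by simp
qed

lemma conv_norm_le_point:
  "(\<Sum>t\<in>carrier R. (conv E f t)\<^sup>2) \<le> real (card E) * (\<Sum>x\<in>E. \<Sum>t\<in>carrier R. (point_conv E f x t)\<^sup>2)"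
proof -
  have "(\<Sum>t\<in>carrier R. (conv E f t)\<^sup>2) \<le> (\<Sum>t\<in>carrier R. (\<Sum>x\<in>E. (point_conv E f x t)\<^sup>2) * real (card E))"
    unfolding conv_def by (intro sum_mono sum_squared_le_sum_of_squares)
  also have "\<dots> = real (card E) * (\<Sum>x\<in>E. \<Sum>t\<in>carrier R. (point_conv E f x t)\<^sup>2)"
    by (subst sum.swap) (simp add: sum_distrib_right mult.commute flip: sum_distrib_left)
  finally show ?thesis .
qed

text \<open>After Cauchy-Schwarz over \<open>x\<close>, nonnegativity allows \<open>x\<close> to run
  over the whole plane, where the terms with \<open>y \<noteq> z\<close> vanish and
  \<open>point_conv_norm\<close> is exact.\<close>

lemma conv_norm_le:
  assumes f: "(\<Sum>s\<in>carrier R. f s) = 0"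
  shows "(\<Sum>t\<in>carrier R. (conv E f t)\<^sup>2) \<le> (real (order R) * real (card E))\<^sup>2 * (\<Sum>t\<in>carrier R. (f t)\<^sup>2)"
proof -
  have "(\<Sum>x\<in>E. \<Sum>t\<in>carrier R. (point_conv E f x t)\<^sup>2) \<le> (\<Sum>x\<in>plane. \<Sum>t\<in>carrier R. (point_conv E f x t)\<^sup>2)"
    using E finite_plane by (intro sum_mono2 sum_nonneg) auto
  then have "real (card E) * (\<Sum>x\<in>E. \<Sum>t\<in>carrier R. (point_conv E f x t)\<^sup>2) \<le>
      real (card E) * (real (card E) * (real (order R))\<^sup>2 * (\<Sum>t\<in>carrier R. (f t)\<^sup>2))"
    unfolding point_conv_norm[OF f] by (intro mult_left_mono) auto
  then show ?thesis using conv_norm_le_point[of f] by (simp add: power2_eq_square mult_ac)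
qed

lemma sum_conv: "(\<Sum>t\<in>carrier R. conv E f t) = (real (card E))\<^sup>2 * (\<Sum>t\<in>carrier R. f t)"
proof -
  have "(\<Sum>t\<in>carrier R. conv E f t) = (\<Sum>x\<in>E. \<Sum>t\<in>carrier R. \<Sum>y\<in>E. f (t \<ominus> sqdist R x y))"
    unfolding conv_def point_conv_def by (rule sum.swap)
  also have "\<dots> = (\<Sum>x\<in>E. \<Sum>y\<in>E. \<Sum>t\<in>carrier R. f (t \<ominus> sqdist R x y))"
    by (intro sum.cong refl sum.swap)
  also have "\<dots> = (\<Sum>x\<in>E. \<Sum>y\<in>E. \<Sum>t\<in>carrier R. f t)"
    by (rule sum.cong[OF refl], rule sum.cong[OF refl], rule sum_translate_minus)
      (rule sqdist_closed_points)
  finally show ?thesis by (simp add: power2_eq_square)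
qed

section \<open>Representation counts and their deviation from the mean\<close>

lemma conv_diff_const: "conv E (\<lambda>t. f t - c) t = conv E f t - (real (card E))\<^sup>2 * c"
  unfolding conv_def point_conv_def by (simp add: sum_subtractf power2_eq_square)

text \<open>Counts \<open>2 j\<close>-tuples of points of \<open>E\<close>, read as \<open>j\<close>
  pairs whose distances add up to \<open>t\<close>. It is the \<open>j\<close>-fold convolution
  power of the distance counts, starting from the unit mass at zero.\<close>

fun reps :: "nat \<Rightarrow> 'a \<Rightarrow> real" where
  "reps 0 = (\<lambda>t. of_bool (t = \<zero>))"
| "reps (Suc j) = conv E (reps j)"

text \<open>There are \<open>card E ^ (2 * j)\<close> tuples spread over \<open>order R\<close>
  values, so the subtracted constant is the mean.\<close>

definition excess :: "nat \<Rightarrow> 'a \<Rightarrow> real" where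
  "excess j t = reps j t - real (card E) ^ (2 * j) / real (order R)"

lemma excess_Suc: "excess (Suc j) = conv E (excess j)"
  unfolding excess_def by (auto simp: conv_diff_const power_add power2_eq_square)

lemma sum_excess: "(\<Sum>t\<in>carrier R. excess j t) = 0"
proof (induction j)
  case 0
  show ?case unfolding excess_def using finite_carrier order_pos zero_closed
    by (auto simp add: sum_subtractf order_def of_bool_def)
next
  case (Suc j)
  then show ?case by (simp add: excess_Suc sum_conv)
qed

lemma sum_reps: "(\<Sum>t\<in>carrier R. reps j t) = real (card E) ^ (2 * j)"
proof -
  have "(\<Sum>t\<in>carrier R. reps j t) = (\<Sum>t\<in>carrier R. excess j t + real (card E) ^ (2 * j) / real (order R))"
    unfolding excess_def by simp
  then show ?thesis using sum_excess order_pos by (simp add: sum.distrib order_def)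
qed

lemma sum_reps_sq:
  "(\<Sum>t\<in>carrier R. (reps j t)\<^sup>2) = real (card E) ^ (4 * j) / real (order R) + (\<Sum>t\<in>carrier R. (excess j t)\<^sup>2)"
proof -
  let ?c = "real (card E) ^ (2 * j) / real (order R)"
  have "(\<Sum>t\<in>carrier R. (reps j t)\<^sup>2) = (\<Sum>t\<in>carrier R. (excess j t + ?c)\<^sup>2)"
    unfolding excess_def by simp
  also have "\<dots> = (\<Sum>t\<in>carrier R. (excess j t)\<^sup>2) + real (order R) * ?c\<^sup>2"
    unfolding sum_add_const_sq sum_excess order_def by simp
  also have "real (order R) * ?c\<^sup>2 = (real (card E) ^ (2 * j))\<^sup>2 / real (order R)"
    using order_pos by (simp add: power_divide power2_eq_square)
  also have "(real (card E) ^ (2 * j))\<^sup>2 = real (card E) ^ (4 * j)"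
    by (simp add: mult.commute flip: power_mult)
  finally show ?thesis by simp
qed

text \<open>Iteration of \<open>conv_norm_le\<close>. It stops at \<open>excess 1\<close> because
  the isosceles count gives more there than another application would.\<close>

lemma excess_norm_le:
  "(\<Sum>t\<in>carrier R. (excess (Suc j) t)\<^sup>2) \<le>
    (real (order R) * real (card E)) ^ (2 * j) * (\<Sum>t\<in>carrier R. (excess 1 t)\<^sup>2)"
proof (induction j)
  case (Suc j)
  have "(\<Sum>t\<in>carrier R. (excess (Suc (Suc j)) t)\<^sup>2) \<le>
      (real (order R) * real (card E))\<^sup>2 * (\<Sum>t\<in>carrier R. (excess (Suc j) t)\<^sup>2)"
    unfolding excess_Suc[of "Suc j"] by (intro conv_norm_le sum_excess)
  also have "\<dots> \<le> (real (order R) * real (card E))\<^sup>2 *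
      ((real (order R) * real (card E)) ^ (2 * j) * (\<Sum>t\<in>carrier R. (excess 1 t)\<^sup>2))"
    by (intro mult_left_mono Suc.IH) auto
  finally show ?case by (simp add: power_add power2_eq_square mult_ac)
qed simp

lemma reps_support:
  "t \<in> carrier R \<Longrightarrow> reps j t \<noteq> 0 \<Longrightarrow> t \<in> kfold_sumset R j (distance_set R E)"
proof (induction j arbitrary: t)
  case 0
  then show ?case unfolding kfold_sumset_def by (auto split: if_splits)
next
  case (Suc j)
  from Suc.prems(2) obtain x y where xy: "x \<in> E" "y \<in> E" "reps j (t \<ominus> sqdist R x y) \<noteq> 0"
    unfolding reps.simps conv_def point_conv_def by (meson sum.not_neutral_contains_not_neutral)
  let ?d = "sqdist R x y"
  have d: "?d \<in> carrier R" "?d \<in> distance_set R E"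
    using sqdist_closed_points xy unfolding distance_set_def by blast+
  have DS: "distance_set R E \<subseteq> carrier R"
    using sqdist_closed_points unfolding distance_set_def by auto
  obtain u where u: "\<forall>i\<in>{1..j}. u i \<in> distance_set R E" "t \<ominus> ?d = (\<Oplus>i\<in>{1..j}. u i)"
    using Suc.IH[OF _ xy(3)] Suc.prems(1) d(1) unfolding kfold_sumset_def by auto
  let ?v = "u(Suc j := ?d)"
  have "(\<Oplus>i\<in>{1..Suc j}. ?v i) = (\<Oplus>i\<in>insert (Suc j) {1..j}. ?v i)"
    by (simp add: atLeastAtMostSuc_conv)
  also have "\<dots> = ?v (Suc j) \<oplus> (\<Oplus>i\<in>{1..j}. ?v i)"
    using u(1) d DS by (intro finsum_insert) auto
  also have "(\<Oplus>i\<in>{1..j}. ?v i) = (\<Oplus>i\<in>{1..j}. u i)"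
    using u(1) DS by (intro finsum_cong') auto
  also have "?v (Suc j) \<oplus> \<dots> = ?d \<oplus> (t \<ominus> ?d)" using u(2) by simp
  also have "\<dots> = t" using d(1) Suc.prems(1) by algebra
  finally have "t = (\<Oplus>i\<in>{1..Suc j}. ?v i)" by (rule sym)
  moreover have "\<forall>i\<in>{1..Suc j}. ?v i \<in> distance_set R E"
    using u(1) d(2) by (auto simp: le_Suc_eq)
  ultimately show ?case unfolding kfold_sumset_def by blast
qed

lemma kfold_sumset_subset: "kfold_sumset R j (distance_set R E) \<subseteq> carrier R"
proof -
  have "distance_set R E \<subseteq> carrier R"
    using sqdist_closed_points unfolding distance_set_def by auto
  then show ?thesis unfolding kfold_sumset_def by (auto intro!: finsum_closed)
qed

lemma card_kfold_le: "card (kfold_sumset R j (distance_set R E)) \<le> order R"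
  unfolding order_def using kfold_sumset_subset finite_carrier by (rule card_mono[rotated])

text \<open>Cauchy-Schwarz on the support: all the mass of \<open>reps j\<close> sits on the
  sumset.\<close>

lemma card_kfold_ge:
  "real (card E) ^ (4 * j) \<le> real (card (kfold_sumset R j (distance_set R E))) *
    (real (card E) ^ (4 * j) / real (order R) + (\<Sum>t\<in>carrier R. (excess j t)\<^sup>2))"
proof -
  let ?K = "kfold_sumset R j (distance_set R E)"
  have "real (card E) ^ (2 * j) = (\<Sum>t\<in>carrier R. reps j t)" by (rule sum_reps[symmetric])
  also have "\<dots> = (\<Sum>t\<in>?K. reps j t)"
    using kfold_sumset_subset finite_carrier reps_support by (intro sum.mono_neutral_right) auto
  finally have "(real (card E) ^ (2 * j))\<^sup>2 = (\<Sum>t\<in>?K. reps j t)\<^sup>2" by simp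
  then have "real (card E) ^ (4 * j) = (\<Sum>t\<in>?K. reps j t)\<^sup>2"
    by (simp add: mult.commute flip: power_mult)
  also have "\<dots> \<le> (\<Sum>t\<in>?K. (reps j t)\<^sup>2) * real (card ?K)"
    by (rule sum_squared_le_sum_of_squares)
  also have "\<dots> \<le> (\<Sum>t\<in>carrier R. (reps j t)\<^sup>2) * real (card ?K)"
    using kfold_sumset_subset finite_carrier by (intro mult_right_mono sum_mono2) auto
  finally show ?thesis unfolding sum_reps_sq by (simp add: mult.commute)
qed

section \<open>The deviation for a single distance\<close>

lemma sum_excess_zero_shifted:
  assumes a: "a \<in> carrier R" "b \<in> carrier R"
  shows "(\<Sum>t\<in>carrier R. excess 0 (t \<ominus> a) * excess 0 (t \<ominus> b)) = of_bool (a = b) - 1 / real (order R)"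
proof -
  let ?q = "real (order R)"
  have ex: "excess 0 (t \<ominus> c) = of_bool (t = c) - 1 / ?q" if "t \<in> carrier R" "c \<in> carrier R" for t c
    unfolding excess_def using that by (simp add: r_right_minus_eq)
  have "(\<Sum>t\<in>carrier R. excess 0 (t \<ominus> a) * excess 0 (t \<ominus> b)) =
      (\<Sum>t\<in>carrier R. of_bool (t = a) * of_bool (t = b) - of_bool (t = a) / ?q - of_bool (t = b) / ?q + 1 / ?q\<^sup>2)"
    using a by (intro sum.cong refl) (simp add: ex algebra_simps power2_eq_square)
  also have "\<dots> = of_bool (a = b) - 1 / ?q - 1 / ?q + ?q * (1 / ?q\<^sup>2)"
    using a finite_carrier
    by (simp add: sum.distrib sum_subtractf order_def of_bool_def if_distrib[of "\<lambda>u. u * _"]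
        flip: sum_divide_distrib cong: if_cong)
  also have "?q * (1 / ?q\<^sup>2) = 1 / ?q" using order_pos by (simp add: power2_eq_square)
  finally show ?thesis by simp
qed

text \<open>Here \<open>x\<close> stays in \<open>E\<close>, unlike in \<open>conv_norm_le\<close>.
  The correlations of the shifted point masses then count isosceles triangles, each term reduced by
  its mean \<open>1 / q\<close>.\<close>

lemma excess_one_le_isosceles:
  "(\<Sum>t\<in>carrier R. (excess 1 t)\<^sup>2) \<le> real (card E) *
    ((\<Sum>y\<in>E. \<Sum>z\<in>E. \<Sum>x\<in>E. of_bool (sqdist R x y = sqdist R x z)) - real (card E) ^ 3 / real (order R))"
proof -
  have "(\<Sum>x\<in>E. \<Sum>t\<in>carrier R. (point_conv E (excess 0) x t)\<^sup>2) =
      (\<Sum>y\<in>E. \<Sum>z\<in>E. \<Sum>x\<in>E. \<Sum>t\<in>carrier R. excess 0 (t \<ominus> sqdist R x y) * excess 0 (t \<ominus> sqdist R x z))"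
    unfolding point_conv_def by (rule sum_square_expand)
  also have "\<dots> = (\<Sum>y\<in>E. \<Sum>z\<in>E. \<Sum>x\<in>E. of_bool (sqdist R x y = sqdist R x z) - 1 / real (order R))"
    by (rule sum.cong[OF refl], rule sum.cong[OF refl], rule sum.cong[OF refl],
        rule sum_excess_zero_shifted; rule sqdist_closed_points)
  also have "\<dots> = (\<Sum>y\<in>E. \<Sum>z\<in>E. \<Sum>x\<in>E. of_bool (sqdist R x y = sqdist R x z)) - real (card E) ^ 3 / real (order R)"
    by (simp only: sum_subtractf) (simp add: power3_eq_cube mult.assoc)
  finally show ?thesis
    using conv_norm_le_point[of "excess 0"] excess_Suc[of 0] by simp
qed

text \<open>The operator bound applied to \<open>excess 0\<close>. It serves as a first estimate
  inside \<open>excess_one_bound\<close>, which improves on it for suitable sizes of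
  \<open>E\<close>.\<close>

lemma excess_one_trivial: "(\<Sum>t\<in>carrier R. (excess 1 t)\<^sup>2) \<le> (real (order R) * real (card E))\<^sup>2"
proof -
  have "(\<Sum>t\<in>carrier R. (excess 0 t)\<^sup>2) = 1 - 1 / real (order R)"
    using sum_excess_zero_shifted[of \<zero> \<zero>] by (simp add: minus_eq power2_eq_square cong: sum.cong)
  also have "\<dots> \<le> 1" by simp
  finally have "(real (order R) * real (card E))\<^sup>2 * (\<Sum>t\<in>carrier R. (excess 0 t)\<^sup>2) \<le>
      (real (order R) * real (card E))\<^sup>2 * 1"
    by (intro mult_left_mono) auto
  then show ?thesis using conv_norm_le[OF sum_excess[of 0]] excess_Suc[of 0] by simp
qed

lemma sum_same_sqdist:
  "(\<Sum>e\<in>E\<times>E. \<Sum>e'\<in>E\<times>E. of_bool (sqdist R (fst e) (snd e) = sqdist R (fst e') (snd e'))) =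
    real (card E) ^ 4 / real (order R) + (\<Sum>t\<in>carrier R. (excess 1 t)\<^sup>2)"
proof -
  let ?d = "\<lambda>e. sqdist R (fst e) (snd e)"
  have d: "?d e \<in> carrier R" if "e \<in> E \<times> E" for e using sqdist_closed_points that by auto
  have "reps 1 t = (\<Sum>e\<in>E\<times>E. of_bool (t = ?d e))" if t: "t \<in> carrier R" for t
  proof -
    have "reps 1 t = (\<Sum>x\<in>E. \<Sum>y\<in>E. of_bool (t = sqdist R x y))"
      using t sqdist_closed_points unfolding One_nat_def reps.simps conv_def point_conv_def
      by (intro sum.cong refl) (simp add: r_right_minus_eq)
    then show ?thesis by (simp add: sum.cartesian_product case_prod_beta)
  qed
  \<comment> \<open>The sum over the one-element set supplies the second outer index that
    \<open>sum_square_expand\<close> expects.\<close>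
  then have "(\<Sum>t\<in>carrier R. (reps 1 t)\<^sup>2) = (\<Sum>x\<in>{()}. \<Sum>t\<in>carrier R. (\<Sum>e\<in>E\<times>E. of_bool (t = ?d e))\<^sup>2)"
    by simp
  also have "\<dots> = (\<Sum>e\<in>E\<times>E. \<Sum>e'\<in>E\<times>E. \<Sum>x\<in>{()}. \<Sum>t\<in>carrier R. of_bool (t = ?d e) * of_bool (t = ?d e'))"
    by (rule sum_square_expand)
  also have "\<dots> = (\<Sum>e\<in>E\<times>E. \<Sum>e'\<in>E\<times>E. of_bool (?d e = ?d e'))"
    using d finite_carrier
    by (simp add: of_bool_def if_distrib[of "\<lambda>u. u * _"] cong: if_cong sum.cong)
  finally show ?thesis using sum_reps_sq[of 1] by simp
qed

end

lemma mirror_plane: "mirror_plane plane lines reflect (sqdist R) (order R)"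
proof
  show "finite plane" by (rule finite_plane)
  show "finite lines" unfolding lines_def normals_def using finite_carrier by simp
  show "order R > 0" using order_pos by simp
  show "card plane = (order R)\<^sup>2" by (rule card_plane)
  show "card lines = order R * (order R + 1)"
    unfolding lines_def by (simp add: card_cartesian_product card_normals flip: order_def)
qed (fact reflect_closed reflect_reflect reflect_isometry ex1_bisector equidistant_fixed
    card_lines_through ex1_line card_common_images)+

text \<open>\<open>same_dst\<close> again involves the norm of \<open>excess 1\<close>. The operator
  bound is good enough for it, because after division by \<open>q\<close> it contributes only
  \<open>q m^2\<close>, the size of a term already present under the root.\<close>

lemma excess_one_bound:
  assumes E: "E \<subseteq> plane" and ne: "E \<noteq> {}"
  defines "q \<equiv> real (order R)" and "m \<equiv> real (card E)"
  shows "(\<Sum>t\<in>carrier R. (excess E 1 t)\<^sup>2) \<le> m ^ 3 + m ^ 3 * sqrt (m / q) + 3 * q * m\<^sup>2 * sqrt m"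
proof -
  interpret M: mirror_plane plane lines reflect "sqdist R" "order R" by (rule mirror_plane)
  let ?N = "\<Sum>t\<in>carrier R. (excess E 1 t)\<^sup>2"
  have fin: "finite E" using E finite_plane by (rule finite_subset)
  have q: "q > 0" unfolding q_def using order_pos .
  have "card E \<ge> 1" using ne fin by (simp add: Suc_leI card_gt_0_iff)
  then have m: "m \<ge> 1" unfolding m_def by simp
  have "M.same_dst E \<le>
      (\<Sum>e\<in>E\<times>E. \<Sum>e'\<in>E\<times>E. of_bool (sqdist R (fst e) (snd e) = sqdist R (fst e') (snd e')))"
    unfolding M.same_dst_def
  proof (rule order_trans[OF sum_mono sum_mono2])
    fix e
    show "(\<Sum>e'\<in>M.npairs E. of_bool (sqdist R (fst e) (snd e) = sqdist R (fst e') (snd e'))) \<le>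
       (\<Sum>e'\<in>E\<times>E. of_bool (sqdist R (fst e) (snd e) = sqdist R (fst e') (snd e')) :: real)"
      using fin by (intro sum_mono2) (auto simp: M.npairs_def)
  qed (use fin in \<open>auto simp: M.npairs_def intro!: sum_nonneg\<close>)
  also have "\<dots> \<le> m ^ 4 / q + (q * m)\<^sup>2"
    using sum_same_sqdist[OF E] excess_one_trivial[OF E] unfolding q_def m_def by simp
  finally have "M.same_dst E / q \<le> (m ^ 4 / q + (q * m)\<^sup>2) / q"
    using q by (intro divide_right_mono) auto
  also have "\<dots> = (m\<^sup>2 / q)\<^sup>2 + q * m\<^sup>2"
    using q by (simp add: field_simps power2_eq_square power4_eq_xxxx)
  finally have sd: "M.same_dst E / q \<le> (m\<^sup>2 / q)\<^sup>2 + q * m\<^sup>2" .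
  have "M.same_dst E / q + 2 * q * m\<^sup>2 + m\<^sup>2 + q * m \<le> (m\<^sup>2 / q)\<^sup>2 + 5 * (q * m\<^sup>2)"
  proof -
    have "q \<ge> 1" unfolding q_def using order_pos by (simp add: Suc_leI)
    then have "m\<^sup>2 \<le> q * m\<^sup>2" using mult_right_mono[of 1 q "m\<^sup>2"] by simp
    moreover have "q * m \<le> q * m\<^sup>2" using m q by (simp add: power2_eq_square)
    ultimately show ?thesis using sd by linarith
  qed
  \<comment> \<open>Raising 5 to 9 makes the bound part of a perfect square, so the root can be
    taken explicitly.\<close>
  also have "\<dots> \<le> (m\<^sup>2 / q + 3 * (sqrt q * m))\<^sup>2"
  proof -
    have "(m\<^sup>2 / q + 3 * (sqrt q * m))\<^sup>2 =
        (m\<^sup>2 / q)\<^sup>2 + 9 * (q * m\<^sup>2) + 6 * (m\<^sup>2 / q * (sqrt q * m))"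
      using q by (simp add: power2_sum power_mult_distrib)
    moreover have "0 \<le> m\<^sup>2 / q * (sqrt q * m)" "0 \<le> q * m\<^sup>2" using q m by auto
    ultimately show ?thesis by linarith
  qed
  finally have "sqrt (M.same_dst E / q + 2 * q * m\<^sup>2 + m\<^sup>2 + q * m) \<le> m\<^sup>2 / q + 3 * (sqrt q * m)"
    using q m by (intro real_le_lsqrt) auto
  then have "sqrt (q * m) * sqrt (M.same_dst E / q + 2 * q * m\<^sup>2 + m\<^sup>2 + q * m) \<le>
      sqrt (q * m) * (m\<^sup>2 / q + 3 * (sqrt q * m))"
    using q m by (intro mult_left_mono) auto
  also have "\<dots> = m\<^sup>2 * sqrt (m / q) + 3 * q * m * sqrt m"
  proof -
    have "sqrt (q * m) / q = sqrt (m / q)"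
      using q by (simp add: real_sqrt_mult real_sqrt_divide real_div_sqrt field_simps)
    then have "sqrt (q * m) * (m\<^sup>2 / q) = m\<^sup>2 * sqrt (m / q)" by (metis times_divide_eq_right mult.commute)
    moreover have "sqrt (q * m) * (3 * (sqrt q * m)) = 3 * (sqrt q * sqrt q) * m * sqrt m"
      by (simp add: real_sqrt_mult)
    ultimately show ?thesis using q by (simp add: distrib_left)
  qed
  finally have "(\<Sum>y\<in>E. \<Sum>z\<in>E. \<Sum>x\<in>E. of_bool (sqdist R x y = sqdist R x z)) - m ^ 3 / q \<le>
      m\<^sup>2 + (m\<^sup>2 * sqrt (m / q) + 3 * q * m * sqrt m)"
    using M.isosceles_bound[OF E] unfolding q_def m_def by linarith
  then have "m * ((\<Sum>y\<in>E. \<Sum>z\<in>E. \<Sum>x\<in>E. of_bool (sqdist R x y = sqdist R x z)) - m ^ 3 / q) \<le>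
      m * (m\<^sup>2 + (m\<^sup>2 * sqrt (m / q) + 3 * q * m * sqrt m))"
    using m by (intro mult_left_mono) auto
  also have "\<dots> = m ^ 3 + m ^ 3 * sqrt (m / q) + 3 * q * m\<^sup>2 * sqrt m"
    by (simp add: algebra_simps power2_eq_square power3_eq_cube)
  finally show ?thesis
    using excess_one_le_isosceles[OF E] unfolding q_def m_def by linarith
qed

end

subsection \<open>Asymptotics\<close>

text \<open>The third term of the bound on \<open>N\<close> is critical: its contribution divided by
  \<open>m^(4 k)\<close> is \<open>3 q^(2 k) / m^(2 k - 1/2)\<close>, which is three times
  \<open>\<theta>\<close> to the power \<open>(4 k - 1) / 2\<close>. This explains the exponent in
  \<open>\<theta>\<close>. The other terms give the powers \<open>2 k - 1\<close> and
  \<open>2 k - 3/2\<close> of \<open>q / m\<close>, which is at most \<open>\<theta>\<close>. The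
  constant is \<open>1 + 1 + 3\<close>.\<close>

lemma relative_excess_bound:
  fixes q m \<theta> :: real and k :: nat
  assumes k: "k \<ge> 2" and q: "q \<ge> 1" and m: "m > 0"
    and \<theta>: "\<theta> = q powr (1 + 1 / (4 * real k - 1)) / m" "\<theta> \<le> 1"
    and N: "N \<le> m ^ 3 + m ^ 3 * sqrt (m / q) + 3 * q * m\<^sup>2 * sqrt m"
  shows "q * ((q * m) ^ (2 * (k - 1)) * N) \<le> 5 * \<theta> * m ^ (4 * k)"
proof -
  define r where "r = real k"
  have r: "r \<ge> 2" using k unfolding r_def by simp
  define s where "s = 1 + 1 / (4 * r - 1)"
  have s: "s * ((4 * r - 1) / 2) = 2 * r" "s \<ge> 1" unfolding s_def using r by (simp_all add: field_simps)
  have th0: "\<theta> > 0" unfolding \<theta> using q m by simp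
  \<comment> \<open>All exponents that occur are at least 1, so \<open>\<theta> \<le> 1\<close>
    reduces each power to \<open>\<theta>\<close> itself.\<close>
  have small: "\<theta> powr a \<le> \<theta>" if "a \<ge> 1" for a
    using powr_mono'[of 1 a \<theta>] that th0 \<theta>(2) by simp
  have "q powr 1 \<le> q powr s" using s q by (intro powr_mono) auto
  then have qm: "q / m \<le> \<theta>" unfolding \<theta> s_def r_def using q m by (simp add: divide_right_mono)
  have qm0: "q / m > 0" using q m by simp
  have ratio: "(q / m) powr a \<le> \<theta>" if "a \<ge> 1" for a
    using powr_mono2[of a "q / m" \<theta>] small[OF that] that qm qm0 by linarith
  have pk: "q * (q * m) ^ (2 * (k - 1)) = q powr (2 * r - 1) * m powr (2 * r - 2)"
  proof -
    have "real (2 * (k - 1)) = 2 * r - 2" using k unfolding r_def by (simp add: of_nat_diff)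
    then have "(q * m) ^ (2 * (k - 1)) = q powr (2 * r - 2) * m powr (2 * r - 2)"
      using q m powr_realpow[of "q * m" "2 * (k - 1)"] by (simp add: powr_mult)
    moreover have "q * q powr (2 * r - 2) = q powr (2 * r - 1)"
      using q powr_add[of q 1 "2 * r - 2"] by simp
    ultimately show ?thesis by (simp add: mult.assoc[symmetric])
  qed
  have m4: "m ^ (4 * k) = m powr (4 * r)"
    using m powr_realpow[of m "4 * k"] unfolding r_def by simp
  have qmp: "q powr a * m powr b = (q / m) powr a * m powr (a + b)" for a b
    using q m by (simp add: powr_divide powr_add)
  have m3: "m ^ 3 = m powr 3" "m\<^sup>2 = m powr 2" using m by (simp_all add: powr_numeral)
  have t1: "q powr (2 * r - 1) * m powr (2 * r - 2) * m ^ 3 \<le> \<theta> * m powr (4 * r)"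
  proof -
    have "q powr (2 * r - 1) * m powr (2 * r - 2) * m ^ 3 = q powr (2 * r - 1) * m powr (2 * r + 1)"
      unfolding m3 by (simp add: add.commute flip: powr_add)
    also have "\<dots> = (q / m) powr (2 * r - 1) * m powr (4 * r)" unfolding qmp by simp
    also have "\<dots> \<le> \<theta> * m powr (4 * r)" using ratio[of "2 * r - 1"] r by (intro mult_right_mono) auto
    finally show ?thesis .
  qed
  have t2: "q powr (2 * r - 1) * m powr (2 * r - 2) * (m ^ 3 * sqrt (m / q)) \<le> \<theta> * m powr (4 * r)"
  proof -
    have "sqrt (m / q) = (m / q) powr (1/2)" using q m by (simp add: powr_half_sqrt)
    also have "\<dots> = m powr (1/2) * q powr (-(1/2))"
      using q m by (simp only: powr_divide powr_minus_divide times_divide_eq_right mult_1_right)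
    finally
    have "q powr (2 * r - 1) * m powr (2 * r - 2) * (m ^ 3 * sqrt (m / q)) =
        (q powr (2 * r - 1) * q powr (-(1/2))) * (m powr (2 * r - 2) * m powr 3 * m powr (1/2))"
      unfolding m3 by (simp add: mult_ac)
    also have "\<dots> = q powr (2 * r - 3/2) * m powr (2 * r + 3/2)"
      by (simp add: add.commute flip: powr_add)
    also have "\<dots> = (q / m) powr (2 * r - 3/2) * m powr (4 * r)" unfolding qmp by simp
    also have "\<dots> \<le> \<theta> * m powr (4 * r)" using ratio[of "2 * r - 3/2"] r by (intro mult_right_mono) auto
    finally show ?thesis .
  qed
  have t3: "q powr (2 * r - 1) * m powr (2 * r - 2) * (q * m\<^sup>2 * sqrt m) \<le> \<theta> * m powr (4 * r)"
  proof -
    have "sqrt m = m powr (1/2)" using m by (simp add: powr_half_sqrt)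
    then have "q powr (2 * r - 1) * m powr (2 * r - 2) * (q * m\<^sup>2 * sqrt m) =
        (q powr (2 * r - 1) * q powr 1) * (m powr (2 * r - 2) * m powr 2 * m powr (1/2))"
      unfolding m3 using q by (simp add: mult_ac)
    also have "\<dots> = q powr (2 * r) * m powr (2 * r + 1/2)"
      unfolding powr_add[symmetric] by simp
    also have "q powr (2 * r) = (\<theta> * m) powr ((4 * r - 1) / 2)"
    proof -
      have "\<theta> * m = q powr s" unfolding \<theta> s_def r_def using m by simp
      then show ?thesis using s by (simp add: powr_powr)
    qed
    also have "\<dots> * m powr (2 * r + 1/2) = \<theta> powr ((4 * r - 1) / 2) * m powr (4 * r)"
    proof -
      have "(4 * r - 1) / 2 + (2 * r + 1/2) = 4 * r" by (simp add: field_simps)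
      then show ?thesis
        using th0 m powr_add[of m "(4 * r - 1) / 2" "2 * r + 1/2"] by (simp only: powr_mult mult.assoc)
    qed
    also have "\<dots> \<le> \<theta> * m powr (4 * r)" using small[of "(4 * r - 1) / 2"] r by (intro mult_right_mono) auto
    finally show ?thesis .
  qed
  let ?P = "q powr (2 * r - 1) * m powr (2 * r - 2)"
  have "q * ((q * m) ^ (2 * (k - 1)) * N) = ?P * N" using pk by (simp add: mult.assoc)
  also have "\<dots> \<le> ?P * (m ^ 3 + m ^ 3 * sqrt (m / q) + 3 * q * m\<^sup>2 * sqrt m)"
    by (intro mult_left_mono N) simp
  also have "\<dots> = ?P * m ^ 3 + ?P * (m ^ 3 * sqrt (m / q)) + 3 * (?P * (q * m\<^sup>2 * sqrt m))"
    by (simp add: algebra_simps)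
  also have "\<dots> \<le> 5 * \<theta> * m powr (4 * r)" using t1 t2 t3 by linarith
  finally show ?thesis unfolding m4 .
qed

text \<open>Cauchy-Schwarz on the sumset bounds the density below by the mean part of the second
  moment over the whole; the relative size of the deviation is at most
  \<open>5 \<theta>\<close>.\<close>

lemma (in plane_field) kfold_density:
  assumes E: "E \<subseteq> plane" and ne: "E \<noteq> {}" and k: "k \<ge> 2"
    and \<theta>: "\<theta> = real (order R) powr (1 + 1 / (4 * real k - 1)) / real (card E)" "\<theta> \<le> 1"
  shows "1 / (1 + 5 * \<theta>) \<le> real (card (kfold_sumset R k (distance_set R E))) / real (order R)"
proof -
  let ?q = "real (order R)" and ?m = "real (card E)"
  let ?K = "real (card (kfold_sumset R k (distance_set R E)))"
  let ?X = "\<Sum>t\<in>carrier R. (excess E k t)\<^sup>2"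
  have m: "?m > 0" using ne E finite_plane by (simp add: card_gt_0_iff finite_subset)
  have q: "?q \<ge> 1" using order_pos by (simp add: Suc_leI)
  have "Suc (k - 1) = k" using k by simp
  then have "?X \<le> (?q * ?m) ^ (2 * (k - 1)) * (\<Sum>t\<in>carrier R. (excess E 1 t)\<^sup>2)"
    using excess_norm_le[OF E, of "k - 1"] by simp
  then have "?q * ?X \<le> ?q * ((?q * ?m) ^ (2 * (k - 1)) * (\<Sum>t\<in>carrier R. (excess E 1 t)\<^sup>2))"
    using q by (intro mult_left_mono) auto
  also have "\<dots> \<le> 5 * \<theta> * ?m ^ (4 * k)"
    by (rule relative_excess_bound[OF k q m \<theta> excess_one_bound[OF E ne]])
  finally have X: "?q * ?X \<le> 5 * \<theta> * ?m ^ (4 * k)" .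
  have "?m ^ (4 * k) \<le> ?K * (?m ^ (4 * k) / ?q + ?X)" by (rule card_kfold_ge[OF E])
  also have "\<dots> = ?K / ?q * (?m ^ (4 * k) + ?q * ?X)" using q by (simp add: field_simps)
  also have "\<dots> \<le> ?K / ?q * (?m ^ (4 * k) + 5 * \<theta> * ?m ^ (4 * k))"
    using X q by (intro mult_left_mono add_left_mono) auto
  also have "\<dots> = (?K / ?q * (1 + 5 * \<theta>)) * ?m ^ (4 * k)"
    by (simp add: algebra_simps add_divide_distrib)
  finally have "1 * ?m ^ (4 * k) \<le> (?K / ?q * (1 + 5 * \<theta>)) * ?m ^ (4 * k)" by simp
  then have "1 \<le> ?K / ?q * (1 + 5 * \<theta>)"
    by (rule mult_right_le_imp_le) (use m in simp)
  moreover have "\<theta> \<ge> 0" unfolding \<theta> using m by simp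
  ultimately show ?thesis by (simp add: divide_le_eq)
qed

theorem theorem1p6:
  fixes k :: nat
    and R :: "nat \<Rightarrow> ('a, 'm) ring_scheme"
    and E :: "nat \<Rightarrow> ('a \<times> 'a) set"
  assumes "k \<ge> 2"
    and "\<And>q. q \<in> admissible_orders \<Longrightarrow> field (R q)"
    and "\<And>q. q \<in> admissible_orders \<Longrightarrow> order (R q) = q"
    and "\<And>q. q \<in> admissible_orders \<Longrightarrow> E q \<subseteq> carrier (R q) \<times> carrier (R q)"
    and "(\<lambda>q. real q powr (1 + 1 / (4 * real k - 1))) \<in> o[admissible_at_top](\<lambda>q. real (card (E q)))"
  shows "((\<lambda>q. real (card (kfold_sumset (R q) k (distance_set (R q) (E q)))) / real q) \<longlongrightarrow> 1)
           admissible_at_top"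
proof -
  let ?F = admissible_at_top
  let ?d = "\<lambda>q. real (card (kfold_sumset (R q) k (distance_set (R q) (E q)))) / real q"
  let ?p = "\<lambda>q. real q powr (1 + 1 / (4 * real k - 1))"
  define \<theta> where "\<theta> q = ?p q / real (card (E q))" for q
  have adm: "eventually (\<lambda>q. q \<in> admissible_orders) ?F"
    unfolding admissible_at_top_def by (simp add: eventually_inf_principal)
  have small: "eventually (\<lambda>q. ?p q \<le> c * real (card (E q))) ?F" if "c > 0" for c
    using landau_o.smallD[OF assms(5) that] by simp
  have pf: "plane_field (R q)" if "q \<in> admissible_orders" for q
  proof -
    have "q mod 4 = 3" using that unfolding admissible_orders_def by simp
    moreover have "q > 0" using calculation by (cases "q = 0") auto
    \<comment> \<open>The carrier is finite because its \<open>card\<close> is positive; an infinite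
      carrier would have order 0.\<close>
    ultimately show ?thesis
      using assms(2,3)[OF that] unfolding plane_field_def plane_field_axioms_def order_def
      by (metis card_gt_0_iff)
  qed
  have nonempty: "E q \<noteq> {}" if "q \<in> admissible_orders" "?p q \<le> 1 * real (card (E q))" for q
  proof -
    have "q > 0" using that(1) unfolding admissible_orders_def by (cases "q = 0") auto
    then have "?p q > 0" by simp
    then show ?thesis using that(2) by (cases "E q = {}") auto
  qed
  have lim0: "(\<theta> \<longlongrightarrow> 0) ?F"
  proof (rule tendstoI)
    fix e :: real assume e: "e > 0"
    have "eventually (\<lambda>q. ?p q \<le> e / 2 * real (card (E q))) ?F" by (rule small) (use e in simp)
    \<comment> \<open>The instance with constant 1 serves to make \<open>E q\<close> nonempty, so
      that dividing by its cardinality is meaningful; \<open>e / 2\<close> above makes the final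
      inequality strict.\<close>
    moreover have "eventually (\<lambda>q. ?p q \<le> 1 * real (card (E q))) ?F" by (rule small) simp
    ultimately show "eventually (\<lambda>q. dist (\<theta> q) 0 < e) ?F" using adm
    proof eventually_elim
      case (elim q)
      interpret plane_field "R q" by (rule pf[OF elim(3)])
      have "finite (E q)" using assms(4)[OF elim(3)] finite_carrier by (auto intro: finite_subset)
      then have "real (card (E q)) > 0" using nonempty[OF elim(3,2)] by (simp add: card_gt_0_iff)
      then have "\<theta> q \<le> e / 2" "\<theta> q \<ge> 0" unfolding \<theta>_def using elim(1) by (simp_all add: divide_le_eq)
      then show ?case using e by simp
    qed
  qed
  have lower: "eventually (\<lambda>q. 1 / (1 + 5 * \<theta> q) \<le> ?d q) ?F"
    using small[of 1, OF zero_less_one] adm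
  proof eventually_elim
    case (elim q)
    interpret plane_field "R q" by (rule pf[OF elim(2)])
    have o: "order (R q) = q" by (rule assms(3)[OF elim(2)])
    have E: "E q \<subseteq> plane" unfolding plane_def by (rule assms(4)[OF elim(2)])
    have ne: "E q \<noteq> {}" by (rule nonempty[OF elim(2,1)])
    then have "real (card (E q)) > 0" using E finite_plane by (simp add: card_gt_0_iff finite_subset)
    then have "\<theta> q \<le> 1" unfolding \<theta>_def using elim(1) by simp
    then show ?case using kfold_density[OF E ne assms(1), of "\<theta> q"] o unfolding \<theta>_def by simp
  qed
  have upper: "eventually (\<lambda>q. ?d q \<le> 1) ?F"
    using adm
  proof eventually_elim
    case (elim q)
    interpret plane_field "R q" by (rule pf[OF elim])
    have "E q \<subseteq> plane" unfolding plane_def by (rule assms(4)[OF elim])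
    then show ?case using card_kfold_le[of "E q" k] assms(3)[OF elim]
      by (simp add: divide_le_eq)
  qed
  have "((\<lambda>q. 1 / (1 + 5 * \<theta> q)) \<longlongrightarrow> 1 / (1 + 5 * 0)) ?F"
    by (intro tendsto_intros lim0) simp
  then have "((\<lambda>q. 1 / (1 + 5 * \<theta> q)) \<longlongrightarrow> 1) ?F" by simp
  \<comment> \<open>The density lies between \<open>1 / (1 + 5 * \<theta> q)\<close> and 1
    eventually along the admissible orders.\<close>
  then show ?thesis by (rule tendsto_sandwich[OF lower upper _ tendsto_const])
qed

end
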